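(* For real $\alpha>0$, $\alpha\ne\frac12$, let $c_\alpha$ be the constant such that, for $f_1\in A(\mathbb T,3/2)$ strictly positive on the torus $\mathbb T$, $\lambda_{\min}\bigl(T_N(|1-\chi|^{2\alpha}f_1)\bigr)\sim\frac{c_\alpha}{N^{2\alpha}}f_1(1)$ as $N\to\infty$. Then, as $\alpha$ tends to $+\infty$ through the real numbers, $$c_\alpha=\sqrt{8\pi\alpha}\,\left(\frac{4\alpha}{e}\right)^{2\alpha}\left(1+O\!\left(\frac1{\sqrt\alpha}\right)\right).$$
   Context: $\chi(\theta)=e^{i\theta}$. $\hat h(j)=\frac1{2\pi}\int_{-\pi}^{\pi}h(e^{i\theta})e^{-ij\theta}\,d\theta$. For $h\in L^1(\mathbb T)$, $T_N(h)$ is the $(N+1)\times(N+1)$ Toeplitz matrix with entries $(T_N(h))_{k+1,l+1}=\hat h(l-k)$, $0\le k,l\le N$, and $\lambda_{\min}$ denotes the smallest eigenvalue. The class $A(\mathbb T,\nu)$ is the set of $c\in L^2(\mathbb T)$ with $\sum_{n\in\mathbb Z}|n|^{\nu}|\hat c(n)|<\infty$. The constant $c_\alpha$ depends only on $\alpha$ (not on $f_1$). *)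

theory Defs
  imports
    "HOL-Analysis.Analysis"
    "HOL-Library.Landau_Symbols"
    "Jordan_Normal_Form.Char_Poly"
begin

text \<open>
  Functions on the torus are functions of a complex argument, of which only the values on
  the unit circle \<^term>\<open>sphere (0::complex) 1\<close> matter.
\<close>

definition fourier_coeff :: "(complex \<Rightarrow> complex) \<Rightarrow> int \<Rightarrow> complex" where
  "fourier_coeff h j =
     1 / (2 * complex_of_real pi) * (LBINT \<theta>:{-pi..pi}. h (cis \<theta>) * cis (- of_int j * \<theta>))"

text \<open>
  \<^term>\<open>Matrix.mat\<close> indexes rows and columns from 0, so the entry at \<open>(k, l)\<close> below is
  \<open>(T\<^sub>N(h))\<^bsub>k+1,l+1\<^esub>\<close> in the usual 1-based numbering.
\<close>

definition toeplitz :: "nat \<Rightarrow> (complex \<Rightarrow> complex) \<Rightarrow> complex Matrix.mat" where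
  "toeplitz N h = Matrix.mat (N + 1) (N + 1) (\<lambda>(k, l). fourier_coeff h (int l - int k))"

text \<open>
  Meaningful for Hermitian matrices of positive dimension, whose eigenvalues are all real;
  \<open>toeplitz N h\<close> is one whenever \<open>h\<close> is real-valued.
\<close>

definition lambda_min :: "complex Matrix.mat \<Rightarrow> real" where
  "lambda_min A = Min {x. eigenvalue A (complex_of_real x)}"

definition L2_torus :: "(complex \<Rightarrow> complex) set" where
  "L2_torus = {c. set_borel_measurable lborel {-pi..pi} (\<lambda>\<theta>. c (cis \<theta>)) \<and>
                  set_integrable lborel {-pi..pi} (\<lambda>\<theta>. (cmod (c (cis \<theta>)))\<^sup>2)}"

text \<open>
  The members are functions, not classes modulo null sets.  For \<open>\<nu> \<ge> 0\<close> each class has a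
  unique continuous representative (its Fourier series converges absolutely); a statement
  about point values of a member has to ask for continuity in addition.
\<close>

definition A_torus :: "real \<Rightarrow> (complex \<Rightarrow> complex) set" where
  "A_torus \<nu> = {c \<in> L2_torus.
     (\<lambda>n::int. \<bar>real_of_int n\<bar> powr \<nu> * cmod (fourier_coeff c n)) summable_on UNIV}"

end

theory Submission
  imports Defs "HOL-Real_Asymp.Real_Asymp"
begin

text \<open>
  It suffices to take \<open>f\<^sub>1 = 1\<close>.  The Toeplitz entries are then explicit quotients of Gamma values, and
  the vectors \<open>v\<^sup>n\<close> with entries \<open>(\<alpha>+1)\<^sub>k (\<alpha>+1)\<^bsub>n-k\<^esub> / (k! (n-k)!)\<close> satisfy \<open>T\<^sub>n v\<^sup>n = t\<^sub>0 (1, \<dots>, 1)\<close> with a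
  constant \<open>t\<^sub>0\<close> that does not depend on \<open>n\<close>.
  The Rayleigh quotient of \<open>v\<^sup>N\<close> bounds the smallest eigenvalue from above.
  The differences \<open>v\<^sup>n - v\<^bsup>n-1\<^esup>\<close> are orthogonal with respect to the Toeplitz form, so they give the trace of the
  inverse matrix, whose reciprocal bounds the smallest eigenvalue from below.
  Comparing squares of Pochhammer quotients with single Pochhammer quotients makes all sums Vandermonde
  convolutions, and after multiplication by \<open>N\<^bsup>2\<alpha>\<^esup>\<close> both bounds converge to \<open>\<Gamma>(4\<alpha>) \<Gamma>(\<alpha>)\<^sup>2 / \<Gamma>(2\<alpha>)\<^sup>2\<close> times
  \<open>2\<alpha> - 1\<close> and \<open>\<alpha> (4\<alpha> + 1) / (2\<alpha> + 1)\<close>, respectively.  Both factors are \<open>2\<alpha> (1 + O(1/\<alpha>))\<close>, and Stirling's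
  formula finishes the proof, even with the error \<open>O(1/\<alpha>)\<close>.
\<close>

section \<open>A finite-difference identity for the Toeplitz entries\<close>

text \<open>Up to sign, the sum is the n-th finite difference of the polynomial at 0. Each
  differencing lowers the degree by one and multiplies the leading coefficient by the degree, so
  only the top coefficient survives, with factor n!.\<close>

lemma alternating_binomial_poly_sum:
  fixes p :: "real Polynomial.poly"
  assumes "degree p \<le> n"
  shows "(\<Sum>k\<le>n. (-1) ^ k * real (n choose k) * poly p (real k)) = (-1) ^ n * fact n * Polynomial.coeff p n"
  using assms
proof (induction n arbitrary: p)
  case 0
  then obtain c where "p = [:c:]"
    by (metis degree_eq_zeroE le_zero_eq)
  then show ?case by simp
next
  case (Suc n)
  define q where "q = p - pcompose p [:1, 1:]"
  have deg_q: "degree q \<le> n" and coeff_q: "Polynomial.coeff q n = - real (Suc n) * Polynomial.coeff p (Suc n)"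
  proof -
    \<comment> \<open>Proved by a separate induction that peels off the constant coefficient: for p
      = a + x r(x) one has p(x) - p(x+1) = x (r(x) - r(x+1)) - r(x+1).\<close>
    have *: "degree (p - pcompose p [:1, 1:]) \<le> n \<and>
        Polynomial.coeff (p - pcompose p [:1, 1:]) n = - real (Suc n) * Polynomial.coeff p (Suc n)"
      if "degree p \<le> Suc n" for n and p :: "real Polynomial.poly"
      using that
    proof (induction n arbitrary: p)
      case 0
      obtain a r where p: "p = pCons a r" by (metis pCons_cases)
      with 0 have "degree r = 0" by (cases "r = 0") auto
      then obtain b where "r = [:b:]" by (metis degree_eq_zeroE)
      with p show ?case by (simp add: pcompose_pCons)
    next
      case (Suc n)
      obtain a r where p: "p = pCons a r" by (metis pCons_cases)
      with Suc.prems have r: "degree r \<le> Suc n" by (cases "r = 0") auto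
      let ?s = "pcompose r [:1, 1:]"
      have eq: "p - pcompose p [:1, 1:] = pCons 0 (r - ?s) - ?s"
        by (simp add: p pcompose_pCons)
      have deg_s: "degree ?s = degree r" by simp
      have s: "Polynomial.coeff ?s (Suc n) = Polynomial.coeff r (Suc n)"
      proof (cases "degree r = Suc n")
        case True
        then have "Polynomial.coeff ?s (Suc n) = lead_coeff ?s" by simp
        also have "\<dots> = lead_coeff r" by (subst lead_coeff_comp) auto
        finally show ?thesis using True by simp
      next
        case False
        then have "degree r < Suc n" using r by simp
        then show ?thesis by (simp add: coeff_eq_0)
      qed
      note IH = Suc.IH[OF r]
      have "degree (pCons 0 (r - ?s)) \<le> Suc n"
        using IH by (cases "r - ?s = 0") auto
      then have "degree (p - pcompose p [:1, 1:]) \<le> Suc n"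
        unfolding eq using r deg_s by (intro degree_diff_le) auto
      moreover have "Polynomial.coeff (p - pcompose p [:1, 1:]) (Suc n)
          = Polynomial.coeff (r - ?s) n - Polynomial.coeff r (Suc n)"
        unfolding eq using s by simp
      ultimately show ?case using IH by (simp add: p algebra_simps)
    qed
    show "degree q \<le> n" "Polynomial.coeff q n = - real (Suc n) * Polynomial.coeff p (Suc n)"
      using *[OF Suc.prems] by (auto simp: q_def)
  qed
  have q: "poly q x = poly p x - poly p (1 + x)" for x
    by (simp add: q_def poly_pcompose add.commute)
  let ?f = "\<lambda>k. (-1) ^ k * poly p (real k)"
  have "(\<Sum>k\<le>Suc n. (-1) ^ k * real (Suc n choose k) * poly p (real k))
      = ?f 0 + (\<Sum>k\<le>n. (-1) ^ Suc k * real (Suc n choose Suc k) * poly p (real (Suc k)))"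
    by (subst sum.atMost_Suc_shift) simp
  \<comment> \<open>Pascal's rule splits the binomial coefficient, so that the sum of order n+1 for
    \<open>p\<close> recombines into the sum of order n for \<open>q\<close>.\<close>
  also have "(\<Sum>k\<le>n. (-1) ^ Suc k * real (Suc n choose Suc k) * poly p (real (Suc k)))
      = (\<Sum>k\<le>n. real (n choose k) * ?f (Suc k)) + (\<Sum>k\<le>n. real (n choose Suc k) * ?f (Suc k))"
    by (subst sum.distrib[symmetric], intro sum.cong) (auto simp: algebra_simps)
  also have "?f 0 + ((\<Sum>k\<le>n. real (n choose k) * ?f (Suc k)) + (\<Sum>k\<le>n. real (n choose Suc k) * ?f (Suc k)))
      = (\<Sum>k\<le>Suc n. real (n choose k) * ?f k) + (\<Sum>k\<le>n. real (n choose k) * ?f (Suc k))"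
    by (subst sum.atMost_Suc_shift) simp
  also have "\<dots> = (\<Sum>k\<le>n. (-1) ^ k * real (n choose k) * poly q (real k))"
    by (simp add: q sum.distrib[symmetric] algebra_simps sum_subtractf[symmetric])
  also have "\<dots> = (-1) ^ n * fact n * Polynomial.coeff q n"
    by (rule Suc.IH[OF deg_q])
  finally show ?case by (simp add: coeff_q algebra_simps)
qed

lemma degree_lead_coeff_prod_linear:
  fixes a :: "nat \<Rightarrow> real"
  assumes "b \<noteq> 0"
  shows "degree (\<Prod>i<n. [:a i, b:]) = n" "Polynomial.coeff (\<Prod>i<n. [:a i, b:]) n = b ^ n"
proof -
  show *: "degree (\<Prod>i<n. [:a i, b:]) = n"
    using assms by (subst degree_prod_eq_sum_degree) auto
  have "lead_coeff (\<Prod>i<n. [:a i, b:]) = b ^ n"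
    using assms by (subst lead_coeff_prod) auto
  then show "Polynomial.coeff (\<Prod>i<n. [:a i, b:]) n = b ^ n"
    by (simp only: *)
qed

text \<open>Vandermonde's identity: the terms (a)_k / k! are the Taylor coefficients of (1 -
  x)^(-a), and exponents add under multiplication.\<close>

lemma pochhammer_div_fact_convolution:
  fixes a b :: real
  shows "(\<Sum>k\<le>n. pochhammer a k / fact k * (pochhammer b (n - k) / fact (n - k)))
    = pochhammer (a + b) n / fact n"
proof -
  have "pochhammer (a + b) n / fact n
      = (\<Sum>k\<le>n. real (n choose k) * pochhammer a k * pochhammer b (n - k) / fact n)"
    by (simp add: pochhammer_binomial_sum sum_divide_distrib)
  also have "\<dots> = (\<Sum>k\<le>n. pochhammer a k / fact k * (pochhammer b (n - k) / fact (n - k)))"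
    by (intro sum.cong) (auto simp: binomial_fact field_simps)
  finally show ?thesis ..
qed

text \<open>The Fourier coefficients (-1)^m binomial(2\<alpha>, \<alpha> + m) of |1 -
  z|^(2\<alpha>), identified in \<open>fourier_coeff_symbol\<close>. As \<open>rGamma\<close> is 0
  at the poles of Gamma, the formula also covers integer \<alpha>, where the coefficients with |m| >
  \<alpha> vanish.\<close>

definition symb_coeff :: "real \<Rightarrow> int \<Rightarrow> real" where
  "symb_coeff \<alpha> m = (if even m then 1 else - 1) * Gamma (2 * \<alpha> + 1)
     * rGamma (\<alpha> + 1 + of_int m) * rGamma (\<alpha> + 1 - of_int m)"

text \<open>
  Discrete analogue of \<open>x\<^sup>\<alpha> (1 - x)\<^sup>\<alpha>\<close>, the torsion function of the fractional Laplacian on \<open>[0, 1]\<close>.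
\<close>

definition torsion :: "real \<Rightarrow> nat \<Rightarrow> nat \<Rightarrow> real" where
  "torsion \<alpha> n k = (if k \<le> n then pochhammer (\<alpha> + 1) k / fact k * (pochhammer (\<alpha> + 1) (n - k) / fact (n - k)) else 0)"

text \<open>The argument x itself may be a pole of Gamma: in the application it is \<alpha> + 1 + k
  - j, which can be a nonpositive integer, while x + n stays positive.\<close>

lemma Gamma_pochhammer_rGamma:
  fixes x :: real
  assumes "x + real n > 0"
  shows "rGamma x * Gamma (x + real n) = pochhammer x n"
proof -
  have "Gamma (x + real n) \<noteq> 0" using Gamma_real_pos[OF assms] by simp
  then show ?thesis using pochhammer_rGamma[of x n] by (simp add: rGamma_inverse_Gamma)
qed

lemma symb_coeff_0:
  "symb_coeff \<alpha> 0 = Gamma (2 * \<alpha> + 1) / Gamma (\<alpha> + 1) ^ 2"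
  by (simp add: symb_coeff_def rGamma_inverse_Gamma field_simps power2_eq_square)

lemma symb_coeff_minus: "symb_coeff \<alpha> (- m) = symb_coeff \<alpha> m"
  by (simp add: symb_coeff_def)

lemma symb_coeff_sym: "symb_coeff \<alpha> (int i - int j) = symb_coeff \<alpha> (int j - int i)"
  using symb_coeff_minus[of \<alpha> "int i - int j"] by simp

text \<open>
  As functions of \<open>k\<close>, the quotients of Gamma values in the summand are polynomials of degrees
  \<open>j\<close> and \<open>n - j\<close>, so the sum is an \<open>n\<close>-th finite difference of a polynomial of degree \<open>n\<close>.
\<close>

lemma symb_coeff_torsion:
  assumes \<alpha>: "\<alpha> > 0" and j: "j \<le> n"
  shows "(\<Sum>k\<le>n. symb_coeff \<alpha> (int j - int k) * torsion \<alpha> n k) = symb_coeff \<alpha> 0"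
proof -
  define P where "P = (\<Prod>i<j. [:\<alpha> + 1 - real j + real i, 1:]) * (\<Prod>i<n-j. [:\<alpha> + 1 + real j + real i, - 1:])"
  have "degree P = degree (\<Prod>i<j. [:\<alpha> + 1 - real j + real i, 1:])
      + degree (\<Prod>i<n-j. [:\<alpha> + 1 + real j + real i, - 1:])"
    unfolding P_def by (intro degree_mult_eq) (auto simp: prod_zero_iff)
  then have degP: "degree P = n"
    using j by (simp add: degree_lead_coeff_prod_linear)
  have lcP: "Polynomial.coeff P n = (-1) ^ (n - j)"
    using coeff_mult_degree_sum[of "\<Prod>i<j. [:\<alpha> + 1 - real j + real i, 1:]" "\<Prod>i<n-j. [:\<alpha> + 1 + real j + real i, - 1:]"] j
    by (simp add: P_def degree_lead_coeff_prod_linear)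
  have polyP: "poly P (real k) = pochhammer (\<alpha> + 1 + real k - real j) j * pochhammer (\<alpha> + 1 + real j - real k) (n - j)" for k
    by (auto simp: P_def poly_prod pochhammer_prod atLeast0LessThan algebra_simps intro!: arg_cong2[of _ _ _ _ "(*)"] prod.cong)
  have G: "Gamma (\<alpha> + 1) > 0" using \<alpha> by simp
  have term_eq: "symb_coeff \<alpha> (int j - int k) * torsion \<alpha> n k
      = (-1) ^ j * symb_coeff \<alpha> 0 / fact n * ((-1) ^ k * real (n choose k) * poly P (real k))"
    if k: "k \<le> n" for k
  proof -
    have poch: "pochhammer (\<alpha> + 1) l = Gamma (\<alpha> + 1 + real l) / Gamma (\<alpha> + 1)" for l
    proof -
      have "\<alpha> + 1 \<notin> \<int>\<^sub>\<le>\<^sub>0" using \<alpha> by (auto simp: nonpos_Ints_def)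
      then show ?thesis by (simp add: pochhammer_Gamma)
    qed
    have 1: "rGamma (\<alpha> + 1 + real k - real j) * Gamma (\<alpha> + 1 + real k) = pochhammer (\<alpha> + 1 + real k - real j) j"
      using Gamma_pochhammer_rGamma[of "\<alpha> + 1 + real k - real j" j] \<alpha> by simp
    have 2: "rGamma (\<alpha> + 1 + real j - real k) * Gamma (\<alpha> + 1 + real (n - k)) = pochhammer (\<alpha> + 1 + real j - real k) (n - j)"
    proof -
      have *: "(\<alpha> + 1 + real j - real k) + real (n - j) = \<alpha> + 1 + real (n - k)"
        using j k by (simp add: of_nat_diff)
      show ?thesis
        unfolding *[symmetric] by (rule Gamma_pochhammer_rGamma) (use * \<alpha> in linarith)
    qed
    have sgn: "(if even (int j - int k) then 1 else - 1 :: real) = (-1) ^ j * (-1) ^ k"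
      by (auto simp: minus_one_power_iff)
    have "symb_coeff \<alpha> (int j - int k) = (-1) ^ j * (-1) ^ k * Gamma (2 * \<alpha> + 1) *
        rGamma (\<alpha> + 1 + real j - real k) * rGamma (\<alpha> + 1 + real k - real j)"
      unfolding symb_coeff_def sgn by (simp add: algebra_simps)
    moreover have "torsion \<alpha> n k = Gamma (\<alpha> + 1 + real k) * Gamma (\<alpha> + 1 + real (n - k)) / (Gamma (\<alpha> + 1) ^ 2 * fact k * fact (n - k))"
      using k by (simp add: torsion_def poch power2_eq_square)
    ultimately have "symb_coeff \<alpha> (int j - int k) * torsion \<alpha> n k
      = ((-1) ^ j * (-1) ^ k) * Gamma (2 * \<alpha> + 1) *
         (rGamma (\<alpha> + 1 + real k - real j) * Gamma (\<alpha> + 1 + real k)) *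
         (rGamma (\<alpha> + 1 + real j - real k) * Gamma (\<alpha> + 1 + real (n - k))) / (Gamma (\<alpha> + 1) ^ 2 * fact k * fact (n - k))"
      by simp
    also have "\<dots> = ((-1) ^ j * (-1) ^ k) * Gamma (2 * \<alpha> + 1) * poly P (real k) / (Gamma (\<alpha> + 1) ^ 2 * fact k * fact (n - k))"
      by (simp add: 1 2 polyP)
    also have "\<dots> = (-1) ^ j * symb_coeff \<alpha> 0 / fact n * ((-1) ^ k * real (n choose k) * poly P (real k))"
      using k by (simp add: symb_coeff_0 binomial_fact field_simps)
    finally show ?thesis .
  qed
  have "(\<Sum>k\<le>n. symb_coeff \<alpha> (int j - int k) * torsion \<alpha> n k)
     = (-1) ^ j * symb_coeff \<alpha> 0 / fact n * (\<Sum>k\<le>n. (-1) ^ k * real (n choose k) * poly P (real k))"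
    by (simp add: term_eq sum_distrib_left)
  also have "\<dots> = (-1) ^ j * symb_coeff \<alpha> 0 * ((-1) ^ n * (-1) ^ (n - j))"
    using alternating_binomial_poly_sum[of P n] by (simp add: degP lcP)
  \<comment> \<open>One sign comes from the n-th difference, the other from the slope -1 in the
    second product of \<open>P\<close>. Their product cancels the sign (-1)^j carried by row
    j.\<close>
  also have "(-1) ^ n * (-1) ^ (n - j) = ((-1) ^ j :: real)"
    using j by (auto simp: minus_one_power_iff)
  finally show ?thesis by (simp add: minus_one_power_iff)
qed

section \<open>Fourier coefficients of the symbol\<close>

lemma has_integral_symbol_recurrence:
  fixes \<alpha> :: real and m :: nat
  assumes "\<alpha> > 0"
  shows "((\<lambda>\<theta>. (2 * sin (\<theta> / 2)) powr (2 * \<alpha>) *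
     ((\<alpha> + real m + 1) * cos (real (Suc m) * \<theta>) + (\<alpha> - real m) * cos (real m * \<theta>)))
     has_integral 0) {0..pi}"
proof -
  \<comment> \<open>The integrand is the derivative of \<open>W\<close>, which vanishes at both end points.\<close>
  define W where "W = (\<lambda>\<theta>. (2 * sin (\<theta> / 2)) powr (2 * \<alpha> + 1) * cos ((real m + 1/2) * \<theta>))"
  let ?f = "\<lambda>\<theta>. (2 * sin (\<theta> / 2)) powr (2 * \<alpha>) *
     ((\<alpha> + real m + 1) * cos (real (Suc m) * \<theta>) + (\<alpha> - real m) * cos (real m * \<theta>))"
  have sin_pos: "sin (\<theta> / 2) > 0" if "\<theta> \<in> {0<..<pi}" for \<theta>
    using that by (intro sin_gt_zero) auto
  have cont: "continuous_on {0..pi} W"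
    unfolding W_def using assms
    by (intro continuous_intros continuous_on_powr') (auto intro!: sin_ge_zero)
  have deriv: "(W has_vector_derivative ?f \<theta>) (at \<theta>)" if \<theta>: "\<theta> \<in> {0<..<pi}" for \<theta>
  proof -
    define s where "s = sin (\<theta> / 2)"
    define c where "c = cos (\<theta> / 2)"
    define S where "S = sin ((real m + 1/2) * \<theta>)"
    define C where "C = cos ((real m + 1/2) * \<theta>)"
    have s: "s > 0" using sin_pos[OF \<theta>] by (simp add: s_def)
    \<comment> \<open>The frequency m + 1/2 lies midway between m and m + 1, so both cosines expand
      in the same four quantities that occur in the derivative of \<open>W\<close>.\<close>
    have c1: "cos (real (Suc m) * \<theta>) = C * c - S * s"
    proof -
      have "real (Suc m) * \<theta> = (real m + 1/2) * \<theta> + \<theta> / 2" by (simp add: algebra_simps)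
      then show ?thesis by (simp only: cos_add C_def c_def S_def s_def)
    qed
    have c2: "cos (real m * \<theta>) = C * c + S * s"
    proof -
      have "real m * \<theta> = (real m + 1/2) * \<theta> - \<theta> / 2" by (simp add: algebra_simps)
      then show ?thesis by (simp only: cos_diff C_def c_def S_def s_def)
    qed
    have "((\<lambda>\<theta>. (2 * sin (\<theta> / 2)) powr (2 * \<alpha> + 1)) has_real_derivative
        (2 * \<alpha> + 1) * (2 * s) powr (2 * \<alpha>) * c) (at \<theta>)"
      using sin_pos[OF \<theta>] unfolding s_def c_def
      by (auto intro!: derivative_eq_intros simp: powr_diff field_simps)
    moreover have "((\<lambda>\<theta>. cos ((real m + 1/2) * \<theta>)) has_real_derivative - ((real m + 1/2) * S)) (at \<theta>)"
      unfolding S_def by (auto intro!: derivative_eq_intros)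
    ultimately have "((\<lambda>\<theta>. (2 * sin (\<theta> / 2)) powr (2 * \<alpha> + 1) * cos ((real m + 1/2) * \<theta>)) has_real_derivative
       ((2 * \<alpha> + 1) * (2 * s) powr (2 * \<alpha>) * c) * C - (real m + 1/2) * S * ((2 * s) powr (2 * \<alpha> + 1))) (at \<theta>)"
      unfolding s_def C_def by (rule DERIV_cong[OF DERIV_mult]) (simp add: algebra_simps)
    also have "((2 * \<alpha> + 1) * (2 * s) powr (2 * \<alpha>) * c) * C - (real m + 1/2) * S * ((2 * s) powr (2 * \<alpha> + 1)) = ?f \<theta>"
      unfolding c1 c2 s_def[symmetric] using s by (simp add: powr_add algebra_simps)
    finally show ?thesis by (simp add: W_def has_real_derivative_iff_has_vector_derivative)
  qed
  have "(?f has_integral (W pi - W 0)) {0..pi}"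
    using cont deriv by (intro fundamental_theorem_of_calculus_interior) auto
  moreover have "W 0 = 0" by (simp add: W_def)
  moreover have "cos ((real m + 1/2) * pi) = 0"
    by (auto simp: cos_zero_iff_int2 algebra_simps intro!: exI[of _ "int m"])
  then have "W pi = 0" by (simp add: W_def)
  ultimately show ?thesis by simp
qed

lemma integrable_symbol_cos:
  fixes \<alpha> x :: real
  assumes "\<alpha> > 0"
  shows "(\<lambda>\<theta>. (2 * sin (\<theta> / 2)) powr (2 * \<alpha>) * cos (x * \<theta>)) integrable_on {0..pi}"
  using assms by (intro integrable_continuous_real continuous_intros continuous_on_powr') (auto intro!: sin_ge_zero)

lemma integral_symbol_recurrence:
  fixes \<alpha> :: real and m :: nat
  assumes "\<alpha> > 0"
  shows "(\<alpha> + real m + 1) * integral {0..pi} (\<lambda>\<theta>. (2 * sin (\<theta> / 2)) powr (2 * \<alpha>) * cos (real (Suc m) * \<theta>))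
    = (real m - \<alpha>) * integral {0..pi} (\<lambda>\<theta>. (2 * sin (\<theta> / 2)) powr (2 * \<alpha>) * cos (real m * \<theta>))"
proof -
  let ?I = "\<lambda>m. integral {0..pi} (\<lambda>\<theta>. (2 * sin (\<theta> / 2)) powr (2 * \<alpha>) * cos (real m * \<theta>))"
  have "((\<lambda>\<theta>. (\<alpha> + real m + 1) * ((2 * sin (\<theta> / 2)) powr (2 * \<alpha>) * cos (real (Suc m) * \<theta>))
     + (\<alpha> - real m) * ((2 * sin (\<theta> / 2)) powr (2 * \<alpha>) * cos (real m * \<theta>))) has_integral
     ((\<alpha> + real m + 1) * ?I (Suc m) + (\<alpha> - real m) * ?I m)) {0..pi}"
    by (intro has_integral_add has_integral_mult_right integrable_integral integrable_symbol_cos assms)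
  also have "(\<lambda>\<theta>. (\<alpha> + real m + 1) * ((2 * sin (\<theta> / 2)) powr (2 * \<alpha>) * cos (real (Suc m) * \<theta>))
     + (\<alpha> - real m) * ((2 * sin (\<theta> / 2)) powr (2 * \<alpha>) * cos (real m * \<theta>)))
     = (\<lambda>\<theta>. (2 * sin (\<theta> / 2)) powr (2 * \<alpha>) *
     ((\<alpha> + real m + 1) * cos (real (Suc m) * \<theta>) + (\<alpha> - real m) * cos (real m * \<theta>)))"
    by (simp add: algebra_simps)
  finally have "(\<alpha> + real m + 1) * ?I (Suc m) + (\<alpha> - real m) * ?I m = 0"
    using has_integral_symbol_recurrence[OF assms] by (rule has_integral_unique)
  then show ?thesis by (simp add: algebra_simps)
qed

section \<open>Evaluation of the cosine integrals by a Beta integral and recurrence\<close>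

lemma Gamma_legendre_duplication_real:
  fixes x :: real
  assumes "x > 0"
  shows "Gamma x * Gamma (x + 1/2) = 2 powr (1 - 2 * x) * sqrt pi * Gamma (2 * x)"
proof -
  have "complex_of_real x \<notin> \<int>\<^sub>\<le>\<^sub>0" "complex_of_real x + 1/2 \<notin> \<int>\<^sub>\<le>\<^sub>0"
    using assms by (auto elim!: nonpos_Ints_cases' simp: complex_eq_iff)
  from Gamma_legendre_duplication[OF this]
  have "Gamma (complex_of_real x) * Gamma (complex_of_real (x + 1/2))
      = complex_of_real (exp ((1 - 2 * x) * ln 2)) * complex_of_real (sqrt pi) * Gamma (complex_of_real (2 * x))"
    by (simp add: exp_of_real[symmetric])
  then have "complex_of_real (Gamma x * Gamma (x + 1/2)) = complex_of_real (exp ((1 - 2 * x) * ln 2) * sqrt pi * Gamma (2 * x))"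
    by (simp only: Gamma_complex_of_real of_real_mult[symmetric])
  then have "Gamma x * Gamma (x + 1/2) = exp ((1 - 2 * x) * ln 2) * sqrt pi * Gamma (2 * x)"
    by (simp only: of_real_eq_iff)
  then show ?thesis by (simp add: powr_def)
qed

text \<open>
  The substitution \<open>t = sin\<^sup>2 (\<theta> / 2)\<close> applied directly would lead to an integrand that is singular at
  \<open>t = 1\<close>.  An extra factor \<open>cos\<^sup>2 (\<theta> / 2) = (1 + cos \<theta>) / 2\<close> removes the singularity, and the recurrence
  eliminates the additional cosine integral.
\<close>

lemma integral_symbol:
  fixes \<alpha> :: real
  assumes \<alpha>: "\<alpha> > 1 / 2"
  shows "integral {0..pi} (\<lambda>\<theta>. (2 * sin (\<theta> / 2)) powr (2 * \<alpha>)) = pi * Gamma (2 * \<alpha> + 1) / Gamma (\<alpha> + 1) ^ 2"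
proof -
  let ?I = "\<lambda>m. integral {0..pi} (\<lambda>\<theta>. (2 * sin (\<theta> / 2)) powr (2 * \<alpha>) * cos (real m * \<theta>))"
  \<comment> \<open>Both exponents are positive because \<alpha> > 1/2, so this Beta integrand is
    continuous on the closed interval, as the substitution rule requires.\<close>
  define f where "f = (\<lambda>t::real. t powr (\<alpha> + 1/2 - 1) * (1 - t) powr (3/2 - 1))"
  define g where "g = (\<lambda>\<theta>::real. sin (\<theta> / 2) ^ 2)"
  have f_int: "(f has_integral Beta (\<alpha> + 1/2) (3/2)) {0..1}"
    unfolding f_def using \<alpha> by (intro has_integral_Beta_real) auto
  have "((\<lambda>\<theta>. (sin (\<theta> / 2) * cos (\<theta> / 2)) *\<^sub>R f (g \<theta>)) has_integral (integral {g 0..g pi} f)) {0..pi}"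
  proof (rule has_integral_substitution[where c = 0 and d = 1])
    show "g ` {0..pi} \<subseteq> {0..1}"
      by (auto simp: g_def power_le_one_iff abs_square_le_1)
    show "continuous_on {0..1} f"
      unfolding f_def using \<alpha> by (intro continuous_intros continuous_on_powr') auto
    show "(g has_field_derivative sin (x / 2) * cos (x / 2)) (at x within {0..pi})" for x
      unfolding g_def by (auto intro!: derivative_eq_intros simp: power2_eq_square)
  qed (auto simp: g_def)
  then have "((\<lambda>\<theta>. (sin (\<theta> / 2) * cos (\<theta> / 2)) * f (g \<theta>)) has_integral Beta (\<alpha> + 1/2) (3/2)) {0..pi}"
    using f_int by (simp add: g_def integral_unique)
  moreover have "(sin (\<theta> / 2) * cos (\<theta> / 2)) * f (g \<theta>)
      = 4 powr (- \<alpha>) * ((2 * sin (\<theta> / 2)) powr (2 * \<alpha>) * (1 / 2 + cos \<theta> / 2))" if \<theta>: "\<theta> \<in> {0..pi}" for \<theta>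
  \<comment> \<open>If the sine vanishes, both sides are 0, since \<open>0 powr x = 0\<close>;
    otherwise the powers can be rearranged for a positive base.\<close>
  proof (cases "sin (\<theta> / 2) = 0")
    case False
    then have s: "sin (\<theta> / 2) > 0"
      using \<theta> sin_ge_zero[of "\<theta> / 2"] by fastforce
    have c: "cos (\<theta> / 2) \<ge> 0" using \<theta> by (intro cos_ge_zero) auto
    have "1 - g \<theta> = cos (\<theta> / 2) ^ 2" by (simp add: g_def cos_squared_eq)
    then have "f (g \<theta>) = (sin (\<theta> / 2) ^ 2) powr (\<alpha> - 1/2) * (cos (\<theta> / 2) ^ 2) powr (1/2)"
      by (simp add: f_def g_def)
    also have "(cos (\<theta> / 2) ^ 2) powr (1/2) = cos (\<theta> / 2)"
      using c by (simp add: powr_half_sqrt)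
    also have "(sin (\<theta> / 2) ^ 2) powr (\<alpha> - 1/2) = sin (\<theta> / 2) powr (2 * \<alpha> - 1)"
      using s by (simp add: powr_powr powr_numeral[symmetric] algebra_simps del: powr_numeral)
    finally have "(sin (\<theta> / 2) * cos (\<theta> / 2)) * f (g \<theta>) = sin (\<theta> / 2) powr (2 * \<alpha>) * cos (\<theta> / 2) ^ 2"
      using s by (simp add: powr_diff power2_eq_square)
    also have "cos (\<theta> / 2) ^ 2 = 1 / 2 + cos \<theta> / 2"
      using cos_double_cos[of "\<theta> / 2"] by (simp add: field_simps)
    also have "sin (\<theta> / 2) powr (2 * \<alpha>) = 4 powr (- \<alpha>) * (2 * sin (\<theta> / 2)) powr (2 * \<alpha>)"
    proof -
      have "(2::real) powr (2 * \<alpha>) = 4 powr \<alpha>" using powr_powr[of 2 2 \<alpha>] by simp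
      then show ?thesis using s by (simp add: powr_mult powr_minus field_simps)
    qed
    finally show ?thesis by simp
  qed (use \<alpha> in simp)
  ultimately have "((\<lambda>\<theta>. 4 powr (- \<alpha>) * ((2 * sin (\<theta> / 2)) powr (2 * \<alpha>) * (1 / 2 + cos \<theta> / 2)))
      has_integral Beta (\<alpha> + 1/2) (3/2)) {0..pi}"
    by (subst (asm) has_integral_cong) auto
  moreover have "((\<lambda>\<theta>. 4 powr (- \<alpha>) * (1 / 2 * ((2 * sin (\<theta> / 2)) powr (2 * \<alpha>) * cos (real 0 * \<theta>))
       + 1 / 2 * ((2 * sin (\<theta> / 2)) powr (2 * \<alpha>) * cos (real 1 * \<theta>))))
      has_integral 4 powr (- \<alpha>) * (1 / 2 * ?I 0 + 1 / 2 * ?I 1)) {0..pi}"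
    using \<alpha> by (intro has_integral_add has_integral_mult_right integrable_integral integrable_symbol_cos) auto
  ultimately have eq: "Beta (\<alpha> + 1/2) (3/2) = 4 powr (- \<alpha>) * (1 / 2 * ?I 0 + 1 / 2 * ?I 1)"
    by (elim has_integral_unique) (simp add: algebra_simps)
  \<comment> \<open>The recurrence at m = 0 expresses the unwanted cosine integral by the wanted
    one, so that \<open>eq\<close> becomes a linear equation for \<open>?I 0\<close> alone.\<close>
  have "(\<alpha> + 1) * ?I 1 = - \<alpha> * ?I 0"
    using integral_symbol_recurrence[of \<alpha> 0] \<alpha> by simp
  then have I1: "?I 1 = - \<alpha> * ?I 0 / (\<alpha> + 1)" using \<alpha> by (simp add: field_simps)
  have I0: "?I 0 = 2 * (\<alpha> + 1) * 4 powr \<alpha> * Beta (\<alpha> + 1/2) (3/2)"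
  proof -
    have "1 / 2 * ?I 0 + 1 / 2 * ?I 1 = ?I 0 / (2 * (\<alpha> + 1))"
      unfolding I1 using \<alpha> by (simp add: field_simps)
    moreover have "4 powr \<alpha> * 4 powr (- \<alpha>) = (1::real)" by (simp add: powr_add[symmetric])
    ultimately have "2 * (\<alpha> + 1) * 4 powr \<alpha> * Beta (\<alpha> + 1/2) (3/2) = 2 * (\<alpha> + 1) * (?I 0 / (2 * (\<alpha> + 1)))"
      unfolding eq by (simp only: mult.assoc) (simp only: mult.assoc[symmetric] mult_1_left)
    then show ?thesis using \<alpha> by simp
  qed
  have G1: "Gamma (3/2 :: real) = sqrt pi / 2"
  proof -
    have "(1/2 :: real) \<notin> \<int>\<^sub>\<le>\<^sub>0" by (auto elim!: nonpos_Ints_cases')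
    from Gamma_plus1[OF this] show ?thesis by (simp add: Gamma_one_half_real)
  qed
  have G2: "Gamma (\<alpha> + 1/2 + 3/2) = (\<alpha> + 1) * Gamma (\<alpha> + 1)"
  proof -
    have "\<alpha> + 1 \<notin> \<int>\<^sub>\<le>\<^sub>0" using \<alpha> by (auto elim!: nonpos_Ints_cases')
    from Gamma_plus1[OF this] show ?thesis by (simp add: add.commute)
  qed
  have D: "4 powr \<alpha> * (Gamma (\<alpha> + 1/2) * Gamma (\<alpha> + 1)) = Gamma (2 * \<alpha> + 1) * sqrt pi"
  proof -
    have "2 powr (1 - 2 * (\<alpha> + 1/2)) = (4::real) powr (- \<alpha>)"
      using powr_powr[of 2 2 "- \<alpha>"] by simp
    moreover have "2 * (\<alpha> + 1/2) = 2 * \<alpha> + 1" "\<alpha> + 1/2 + 1/2 = \<alpha> + 1" by simp_all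
    ultimately have "Gamma (\<alpha> + 1/2) * Gamma (\<alpha> + 1) = 4 powr (- \<alpha>) * sqrt pi * Gamma (2 * \<alpha> + 1)"
      using Gamma_legendre_duplication_real[of "\<alpha> + 1/2"] \<alpha> by (simp add: add.commute)
    moreover have "4 powr \<alpha> * 4 powr (- \<alpha>) = (1::real)" by (simp add: powr_add[symmetric])
    ultimately show ?thesis by (simp only: mult.assoc[symmetric]) simp
  qed
  have "Gamma (\<alpha> + 1) > 0" using \<alpha> by (intro Gamma_real_pos) simp
  then have pos: "Gamma (\<alpha> + 1) \<noteq> 0" by (rule less_imp_neq[THEN not_sym])
  have "?I 0 = 2 * (\<alpha> + 1) * 4 powr \<alpha> * (Gamma (\<alpha> + 1/2) * (sqrt pi / 2) / ((\<alpha> + 1) * Gamma (\<alpha> + 1)))"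
    unfolding I0 Beta_def G1 G2 ..
  also have "\<dots> = 4 powr \<alpha> * Gamma (\<alpha> + 1/2) * sqrt pi / Gamma (\<alpha> + 1)"
    using \<alpha> pos by (simp add: divide_simps)
  also have "\<dots> = sqrt pi * (4 powr \<alpha> * (Gamma (\<alpha> + 1/2) * Gamma (\<alpha> + 1))) / Gamma (\<alpha> + 1) ^ 2"
    using pos by (simp add: power2_eq_square)
  finally show ?thesis unfolding D by simp
qed

text \<open>Both sides satisfy the same first-order recurrence in m: the integrals by
  \<open>integral_symbol_recurrence\<close>, the coefficients by the functional equation of
  \<open>rGamma\<close>. The case m = 0 is \<open>integral_symbol\<close>.\<close>

lemma integral_symbol_cos:
  assumes "\<alpha> > 1 / 2"
  shows "integral {0..pi} (\<lambda>\<theta>. (2 * sin (\<theta> / 2)) powr (2 * \<alpha>) * cos (real m * \<theta>)) = pi * symb_coeff \<alpha> (int m)"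
proof (induction m)
  case 0
  then show ?case using integral_symbol[OF assms] by (simp add: symb_coeff_0)
next
  case (Suc m)
  let ?I = "\<lambda>m. integral {0..pi} (\<lambda>\<theta>. (2 * sin (\<theta> / 2)) powr (2 * \<alpha>) * cos (real m * \<theta>))"
  define s where "s = (if even m then 1 else - 1 :: real)"
  have 1: "(\<alpha> + real m + 1) * rGamma (\<alpha> + 1 + real (Suc m)) = rGamma (\<alpha> + 1 + real m)"
    using rGamma_plus1[of "\<alpha> + 1 + real m"] by (simp add: algebra_simps)
  have 2: "(\<alpha> - real m) * rGamma (\<alpha> + 1 - real m) = rGamma (\<alpha> + 1 - real (Suc m))"
    using rGamma_plus1[of "\<alpha> - real m"] by (simp add: algebra_simps)
  have s1: "symb_coeff \<alpha> (int m) = s * Gamma (2 * \<alpha> + 1) * rGamma (\<alpha> + 1 + real m) * rGamma (\<alpha> + 1 - real m)"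
    by (simp add: symb_coeff_def s_def)
  have s2: "symb_coeff \<alpha> (int (Suc m)) = - s * Gamma (2 * \<alpha> + 1) * rGamma (\<alpha> + 1 + real (Suc m)) * rGamma (\<alpha> + 1 - real (Suc m))"
    by (simp add: symb_coeff_def s_def)
  have "(\<alpha> + real m + 1) * symb_coeff \<alpha> (int (Suc m)) = (real m - \<alpha>) * symb_coeff \<alpha> (int m)"
    unfolding s1 s2 1[symmetric] 2[symmetric] by (simp add: algebra_simps)
  moreover have "(\<alpha> + real m + 1) * ?I (Suc m) = (real m - \<alpha>) * (pi * symb_coeff \<alpha> (int m))"
    using integral_symbol_recurrence[of \<alpha> m] assms by (simp add: Suc)
  ultimately have "(\<alpha> + real m + 1) * ?I (Suc m) = (\<alpha> + real m + 1) * (pi * symb_coeff \<alpha> (int (Suc m)))"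
    by (simp only: mult.left_commute[of _ pi])
  moreover have "\<alpha> + real m + 1 \<noteq> 0" using assms by linarith
  ultimately show ?case by simp
qed

section \<open>From cosine integrals to complex Fourier coefficients\<close>

lemma cmod_one_minus_cis: "cmod (1 - cis \<theta>) = 2 * \<bar>sin (\<theta> / 2)\<bar>"
proof -
  have "(cmod (1 - cis \<theta>))\<^sup>2 = (1 - cos \<theta>)\<^sup>2 + (sin \<theta>)\<^sup>2"
    by (simp add: cmod_power2)
  also have "\<dots> = 2 - 2 * cos \<theta>"
    using sin_cos_squared_add[of \<theta>] by (simp add: power2_eq_square algebra_simps)
  also have "cos \<theta> = 1 - 2 * (sin (\<theta> / 2))\<^sup>2"
    using cos_double_sin[of "\<theta> / 2"] by simp
  finally have "(cmod (1 - cis \<theta>))\<^sup>2 = (2 * \<bar>sin (\<theta> / 2)\<bar>)\<^sup>2"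
    by (simp add: power_mult_distrib)
  then show ?thesis by (rule power2_eq_imp_eq) auto
qed

text \<open>Reflecting \<theta> conjugates the integrand, so the integral over the full period is
  twice the real part of the integral over the upper half, which is the cosine integral of frequency
  |j|.\<close>

lemma fourier_coeff_symbol:
  fixes \<alpha> :: real
  assumes \<alpha>: "\<alpha> > 1 / 2"
  shows "fourier_coeff (\<lambda>z. complex_of_real (cmod (1 - z) powr (2 * \<alpha>))) j = complex_of_real (symb_coeff \<alpha> j)"
proof -
  define g where "g = (\<lambda>\<theta>. complex_of_real (cmod (1 - cis \<theta>) powr (2 * \<alpha>)) * cis (- of_int j * \<theta>))"
  have cont: "continuous_on S g" for S
    unfolding g_def using \<alpha> by (intro continuous_intros continuous_on_powr') auto
  define I where "I = integral {0..pi} g"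
  have g1: "(g has_integral I) {0..pi}"
    unfolding I_def by (intro integrable_integral integrable_continuous_real cont)
  have g_minus: "g (- \<theta>) = cnj (g \<theta>)" for \<theta>
    by (simp add: g_def cmod_one_minus_cis cis_cnj)
  have "((\<lambda>\<theta>. cnj (g \<theta>)) has_integral cnj I) {0..pi}"
    using g1 has_integral_cnj[of g I "{0..pi}"] by (simp add: o_def)
  then have "((\<lambda>\<theta>. g (- \<theta>)) has_integral cnj I) {- 0..- (- pi)}"
    by (simp only: g_minus minus_zero minus_minus)
  then have g2: "(g has_integral cnj I) {- pi..0}"
    by (rule has_integral_reflect_real[THEN iffD1])
  have total: "(g has_integral cnj I + I) {- pi..pi}"
    by (rule has_integral_combine[OF _ _ g2 g1]) auto
  have "Re I = pi * symb_coeff \<alpha> j"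
  proof -
    have "((\<lambda>\<theta>. Re (g \<theta>)) has_integral Re I) {0..pi}"
      using has_integral_Re[OF g1] by simp
    then have "Re I = integral {0..pi} (\<lambda>\<theta>. Re (g \<theta>))" by (simp add: integral_unique)
    also have "\<dots> = integral {0..pi} (\<lambda>\<theta>. (2 * sin (\<theta> / 2)) powr (2 * \<alpha>) * cos (real (nat \<bar>j\<bar>) * \<theta>))"
    proof (rule integral_cong)
      fix \<theta> :: real assume \<theta>: "\<theta> \<in> {0..pi}"
      then have "sin (\<theta> / 2) \<ge> 0" by (intro sin_ge_zero) auto
      moreover have "cos (real_of_int j * \<theta>) = cos (real (nat \<bar>j\<bar>) * \<theta>)"
        by (auto simp: abs_if)
      ultimately show "Re (g \<theta>) = (2 * sin (\<theta> / 2)) powr (2 * \<alpha>) * cos (real (nat \<bar>j\<bar>) * \<theta>)"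
        by (simp add: g_def cmod_one_minus_cis)
    qed
    also have "\<dots> = pi * symb_coeff \<alpha> j"
      by (subst integral_symbol_cos[OF \<alpha>]) (auto simp: abs_if symb_coeff_minus)
    finally show ?thesis .
  qed
  then have "cnj I + I = 2 * complex_of_real pi * complex_of_real (symb_coeff \<alpha> j)"
    by (simp add: complex_eq_iff)
  moreover have "(LBINT \<theta>:{-pi..pi}. g \<theta>) = cnj I + I"
  proof -
    have "set_integrable lborel {-pi..pi} g"
      by (intro borel_integrable_atLeastAtMost' cont)
    then show ?thesis
      using total by (simp add: set_borel_integral_eq_integral(2) integral_unique)
  qed
  ultimately show ?thesis
    by (simp add: fourier_coeff_def g_def)
qed

section \<open>The smallest eigenvalue and the Rayleigh quotient\<close>

text \<open>Reduces complex eigenvectors to real ones: for a real matrix and a real eigenvalue, the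
  real and the imaginary part of an eigenvector solve the same equation, and at least one of them is
  nonzero.\<close>

lemma eigenvalue_real_mat:
  fixes a :: "nat \<Rightarrow> nat \<Rightarrow> real" and \<mu> :: real
  shows "eigenvalue (Matrix.mat n n (\<lambda>(i, j). complex_of_real (a i j))) (complex_of_real \<mu>) \<longleftrightarrow>
    (\<exists>x. (\<exists>i<n. x i \<noteq> 0) \<and> (\<forall>i<n. (\<Sum>j<n. a i j * x j) = \<mu> * x i))"
    (is "eigenvalue ?A _ \<longleftrightarrow> ?R")
proof
  assume "eigenvalue ?A (complex_of_real \<mu>)"
  then obtain v where v: "v \<in> carrier_vec n" "v \<noteq> 0\<^sub>v n" "?A *\<^sub>v v = complex_of_real \<mu> \<cdot>\<^sub>v v"
    by (auto simp: eigenvalue_def eigenvector_def)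
  have eq: "(\<Sum>j<n. complex_of_real (a i j) * vec_index v j) = complex_of_real \<mu> * vec_index v i" if "i < n" for i
  proof -
    have "vec_index (?A *\<^sub>v v) i = (\<Sum>j<n. complex_of_real (a i j) * vec_index v j)"
      using that v(1) by (simp add: scalar_prod_def atLeast0LessThan)
    then show ?thesis using v(1,3) that by simp
  qed
  obtain i where i: "i < n" "vec_index v i \<noteq> 0"
    using v(1,2) by (metis eq_vecI carrier_vecD index_zero_vec)
  have re: "(\<Sum>j<n. a i j * Re (vec_index v j)) = \<mu> * Re (vec_index v i)"
    and im: "(\<Sum>j<n. a i j * Im (vec_index v j)) = \<mu> * Im (vec_index v i)" if "i < n" for i
    using arg_cong[OF eq[OF that], of Re] arg_cong[OF eq[OF that], of Im] by simp_all
  show ?R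
  proof (cases "Re (vec_index v i) = 0")
    case True
    then have "Im (vec_index v i) \<noteq> 0" using i(2) by (simp add: complex_eq_iff)
    then show ?thesis using im i(1) by (intro exI[of _ "\<lambda>j. Im (vec_index v j)"]) blast
  next
    case False
    then show ?thesis using re i(1) by (intro exI[of _ "\<lambda>j. Re (vec_index v j)"]) blast
  qed
next
  assume ?R
  then obtain x i where x: "i < n" "x i \<noteq> 0" "\<And>i. i < n \<Longrightarrow> (\<Sum>j<n. a i j * x j) = \<mu> * x i"
    by blast
  define v where "v = Matrix.vec n (\<lambda>i. complex_of_real (x i))"
  have "v \<noteq> 0\<^sub>v n"
    using x(1,2) by (auto simp: v_def dest: arg_cong[of _ _ "\<lambda>v. vec_index v i"])
  moreover have "?A *\<^sub>v v = complex_of_real \<mu> \<cdot>\<^sub>v v"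
  proof (rule eq_vecI)
    fix i assume "i < dim_vec (complex_of_real \<mu> \<cdot>\<^sub>v v)"
    then have i: "i < n" by (simp add: v_def)
    have "vec_index (?A *\<^sub>v v) i = (\<Sum>j<n. complex_of_real (a i j) * complex_of_real (x j))"
      using i by (simp add: v_def scalar_prod_def atLeast0LessThan)
    also have "\<dots> = complex_of_real (\<Sum>j<n. a i j * x j)" by simp
    also have "\<dots> = vec_index (complex_of_real \<mu> \<cdot>\<^sub>v v) i"
      using i by (simp add: x(3) v_def)
    finally show "vec_index (?A *\<^sub>v v) i = vec_index (complex_of_real \<mu> \<cdot>\<^sub>v v) i" .
  qed (simp add: v_def)
  ultimately show "eigenvalue ?A (complex_of_real \<mu>)"
    unfolding eigenvalue_def eigenvector_def by (intro exI[of _ v]) (simp add: v_def)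
qed

text \<open>The quadratic form attains its minimum on the compact unit sphere, and stationarity at a
  minimiser is the eigenvector equation. Vectors are functions on the naturals of which only the
  first n values matter.\<close>

lemma rayleigh_minimizer:
  fixes a :: "nat \<Rightarrow> nat \<Rightarrow> real"
  assumes n: "n > 0" and sym: "\<And>i j. a i j = a j i"
  shows "\<exists>\<mu> x. (\<exists>i<n. x i \<noteq> 0) \<and> (\<forall>i<n. (\<Sum>j<n. a i j * x j) = \<mu> * x i) \<and>
    (\<forall>y. \<mu> * (\<Sum>i<n. (y i)\<^sup>2) \<le> (\<Sum>i<n. \<Sum>j<n. a i j * y i * y j))"
proof -
  define Q where "Q = (\<lambda>y::nat\<Rightarrow>real. \<Sum>i<n. \<Sum>j<n. a i j * y i * y j)"
  define B where "B = (\<lambda>y z::nat\<Rightarrow>real. \<Sum>i<n. \<Sum>j<n. a i j * y i * z j)"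
  define S where "S = (\<lambda>y::nat\<Rightarrow>real. \<Sum>i<n. (y i)\<^sup>2)"
  define K where "K = PiE {..<n} (\<lambda>_. {-1..1::real}) \<inter> {y. S y = 1}"
  have compact: "compact K"
    unfolding K_def
  proof (rule compact_Int_closed)
    \<comment> \<open>Extensional functions take the value \<open>undefined\<close> outside
      \<open>{..<n}\<close>. The cube is thus a full product of compact factors, singletons from
      index n on, and Tychonoff's theorem applies.\<close>
    have "PiE {..<n} (\<lambda>_. {-1..1::real}) = PiE UNIV (\<lambda>i. if i < n then {-1..1} else {undefined})"
      by (intro Set.set_eqI) (simp add: PiE_iff extensional_def Ball_def, metis singletonD singletonI)
    also have "compactin (product_topology (\<lambda>i. euclidean) UNIV) \<dots>"
      by (subst compactin_PiE) auto
    then have "compact (PiE UNIV (\<lambda>i. if i < n then {-1..1::real} else {undefined}))"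
      by (simp only: euclidean_product_topology compactin_euclidean_iff)
    finally show "compact (PiE {..<n} (\<lambda>_. {-1..1::real}))" .
    have coord: "continuous_on UNIV (\<lambda>x::nat \<Rightarrow> real. x i)" for i
      by (rule continuous_on_product_coordinates)
    have "continuous_on UNIV S" unfolding S_def
      by (intro continuous_on_sum continuous_on_power coord)
    then show "closed {y. S y = 1}"
      using continuous_closed_vimage[of "{1}" S] by (simp add: vimage_def continuous_on_eq_continuous_at)
  qed
  have contQ: "continuous_on K Q" unfolding Q_def
    by (intro continuous_intros continuous_on_subset[OF continuous_on_product_coordinates subset_UNIV])
  have normalize: "(\<lambda>i\<in>{..<n}. y i / sqrt (S y)) \<in> K" "Q (\<lambda>i\<in>{..<n}. y i / sqrt (S y)) = Q y / S y" if "S y \<noteq> 0" for y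
  proof -
    have pos: "S y > 0" using that sum_nonneg[of "{..<n}" "\<lambda>i. (y i)\<^sup>2"] unfolding S_def by simp
    have le: "\<bar>y i\<bar> \<le> sqrt (S y)" if "i < n" for i
    proof -
      have "(y i)\<^sup>2 \<le> S y" unfolding S_def by (rule member_le_sum) (use that in auto)
      then show ?thesis by (metis real_sqrt_abs real_sqrt_le_mono)
    qed
    have "S (\<lambda>i\<in>{..<n}. y i / sqrt (S y)) = (\<Sum>i<n. ((\<lambda>i\<in>{..<n}. y i / sqrt (S y)) i)\<^sup>2)"
      by (simp only: S_def)
    also have "\<dots> = (\<Sum>i<n. (y i)\<^sup>2 / S y)"
      using pos by (intro sum.cong) (auto simp: power_divide)
    also have "\<dots> = 1" using that unfolding sum_divide_distrib[symmetric] by (simp add: S_def)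
    finally show "(\<lambda>i\<in>{..<n}. y i / sqrt (S y)) \<in> K"
      using pos le by (auto simp: K_def abs_le_iff divide_le_eq le_divide_eq minus_le_iff)
    have "Q (\<lambda>i\<in>{..<n}. y i / sqrt (S y)) = (\<Sum>i<n. \<Sum>j<n. a i j * y i * y j / S y)"
      unfolding Q_def using pos by (intro sum.cong) auto
    then show "Q (\<lambda>i\<in>{..<n}. y i / sqrt (S y)) = Q y / S y"
      by (simp add: Q_def sum_divide_distrib)
  qed
  have "S (\<lambda>_. 1) \<noteq> 0" using n by (simp add: S_def)
  then have "K \<noteq> {}" using normalize(1) by blast
  then obtain x where x: "x \<in> K" "\<And>y. y \<in> K \<Longrightarrow> Q x \<le> Q y"
    using continuous_attains_inf[OF compact _ contQ] by blast
  define \<mu> where "\<mu> = Q x"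
  have Sx: "S x = 1" using x(1) by (simp add: K_def)
  have min: "\<mu> * S y \<le> Q y" for y
  proof (cases "S y = 0")
    case True
    then have "\<forall>i<n. y i = 0" by (simp add: S_def sum_nonneg_eq_0_iff)
    then have "Q y = 0" by (simp add: Q_def)
    then show ?thesis using True by simp
  next
    case False
    have pos: "S y > 0" using False sum_nonneg[of "{..<n}" "\<lambda>i. (y i)\<^sup>2"] unfolding S_def by simp
    have "\<mu> \<le> Q y / S y" unfolding \<mu>_def using x(2)[OF normalize(1)[OF False]] normalize(2)[OF False] by simp
    then show ?thesis using pos by (simp add: field_simps)
  qed
  \<comment> \<open>First variation at the minimiser, in the direction of the \<open>i\<close>-th unit vector.\<close>
  define r where "r = (\<lambda>i. (\<Sum>j<n. a i j * x j) - \<mu> * x i)"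
  have "r i = 0" if i: "i < n" for i
  proof (rule ccontr)
    assume r0: "r i \<noteq> 0"
    define e where "e = (\<lambda>j. if j = i then 1 else 0 :: real)"
    have Qt: "Q (\<lambda>j. x j + t * e j) = \<mu> + 2 * t * (\<Sum>j<n. a i j * x j) + t\<^sup>2 * a i i" for t
    proof -
      have "Q (\<lambda>j. x j + t * e j) = (\<Sum>k<n. \<Sum>j<n. a k j * x k * x j + t * (a k j * x k * e j)
          + t * (a k j * e k * x j) + t\<^sup>2 * (a k j * e k * e j))"
        unfolding Q_def by (intro sum.cong refl) (simp add: algebra_simps power2_eq_square)
      also have "\<dots> = Q x + t * (\<Sum>k<n. \<Sum>j<n. a k j * x k * e j) + t * (\<Sum>k<n. \<Sum>j<n. a k j * e k * x j)
          + t\<^sup>2 * (\<Sum>k<n. \<Sum>j<n. a k j * e k * e j)"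
        by (simp only: Q_def sum_distrib_left sum.distrib)
      also have "(\<Sum>k<n. \<Sum>j<n. a k j * x k * e j) = (\<Sum>k<n. a k i * x k)"
        using i by (simp add: e_def if_distrib sum.delta cong: if_cong)
      also have "\<dots> = (\<Sum>j<n. a i j * x j)" by (intro sum.cong refl) (simp add: sym[of _ i])
      also have "(\<Sum>k<n. \<Sum>j<n. a k j * e k * x j) = (\<Sum>j<n. a i j * x j)"
      proof -
        have "(\<Sum>k<n. \<Sum>j<n. a k j * e k * x j) = (\<Sum>k<n. if k = i then (\<Sum>j<n. a i j * x j) else 0)"
          by (intro sum.cong) (auto simp: e_def)
        then show ?thesis using i by simp
      qed
      also have "(\<Sum>k<n. \<Sum>j<n. a k j * e k * e j) = a i i"
      proof -
        have "(\<Sum>j<n. a k j * e k * e j) = (\<Sum>j<n. if j = i then a k i * e k else 0)" for k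
          by (intro sum.cong) (auto simp: e_def)
        then have "(\<Sum>k<n. \<Sum>j<n. a k j * e k * e j) = (\<Sum>k<n. if k = i then a i i else 0)"
          using i by (intro sum.cong) (auto simp: e_def)
        also have "\<dots> = a i i" using i by simp
        finally show ?thesis .
      qed
      finally show ?thesis by (simp add: \<mu>_def algebra_simps)
    qed
    have St: "S (\<lambda>j. x j + t * e j) = 1 + 2 * t * x i + t\<^sup>2" for t
    proof -
      have "S (\<lambda>j. x j + t * e j) = (\<Sum>j<n. (x j)\<^sup>2 + (if j = i then 2 * t * x i + t\<^sup>2 else 0))"
        unfolding S_def by (intro sum.cong) (auto simp: e_def power2_eq_square algebra_simps)
      also have "\<dots> = S x + (2 * t * x i + t\<^sup>2)" using i by (simp add: sum.distrib S_def)
      finally show ?thesis by (simp add: Sx)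
    qed
    have ineq: "0 \<le> 2 * t * r i + t\<^sup>2 * (a i i - \<mu>)" for t
      using min[of "\<lambda>j. x j + t * e j"] unfolding Qt St by (simp add: r_def algebra_simps)
    \<comment> \<open>A positive majorant of the quadratic coefficient. The choice t = - r_i / d
      then makes the nonnegative expression in \<open>ineq\<close> at most - r_i^2 / d, a
      contradiction.\<close>
    define d where "d = \<bar>a i i - \<mu>\<bar> + 1"
    have d: "d > 0" "a i i - \<mu> \<le> d" by (auto simp: d_def)
    have "0 \<le> 2 * (- r i / d) * r i + (- r i / d)\<^sup>2 * (a i i - \<mu>)" by (rule ineq)
    also have "\<dots> \<le> 2 * (- r i / d) * r i + (- r i / d)\<^sup>2 * d"
      using d by (intro add_left_mono mult_left_mono) auto
    also have "\<dots> = - (r i)\<^sup>2 / d" using d(1) by (simp add: power2_eq_square)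
    also have "\<dots> < 0" using d(1) r0 by simp
    finally show False by simp
  qed
  moreover have "\<exists>i<n. x i \<noteq> 0"
  proof (rule ccontr)
    assume "\<not> ?thesis"
    then have "S x = 0" by (simp add: S_def)
    then show False using Sx by simp
  qed
  ultimately show ?thesis
    using min by (intro exI[of _ \<mu>] exI[of _ x]) (simp add: r_def Q_def S_def)
qed

text \<open>Needed because \<open>Min\<close> in \<open>lambda_min\<close> is informative only for a
  finite set.\<close>

lemma finite_real_eigenvalues:
  fixes A :: "complex Matrix.mat"
  assumes "A \<in> carrier_mat n n"
  shows "finite {x. eigenvalue A (complex_of_real x)}"
proof -
  have "char_poly A \<noteq> 0"
    using degree_monic_char_poly[OF assms] by auto
  then have "finite {x. poly (char_poly A) x = 0}" by (rule poly_roots_finite)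
  then have "finite (complex_of_real -` {x. poly (char_poly A) x = 0})"
    by (intro finite_vimageI) (auto simp: inj_on_def)
  then show ?thesis
    by (simp add: eigenvalue_root_char_poly[OF assms] vimage_def)
qed

text \<open>The Rayleigh minimum is itself an eigenvalue, so \<open>lambda_min\<close> cannot exceed
  it; conversely, inserting an eigenvector into a lower bound for the form bounds its eigenvalue.
  Test vectors thus give upper bounds, and coercivity estimates give lower bounds.\<close>

lemma lambda_min_bounds:
  fixes a :: "nat \<Rightarrow> nat \<Rightarrow> real"
  assumes n: "n > 0" and sym: "\<And>i j. a i j = a j i"
  defines "A \<equiv> Matrix.mat n n (\<lambda>(i, j). complex_of_real (a i j))"
  shows lambda_min_le_rayleigh: "\<And>y. lambda_min A * (\<Sum>i<n. (y i)\<^sup>2) \<le> (\<Sum>i<n. \<Sum>j<n. a i j * y i * y j)"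
    and lambda_min_ge: "\<And>L. (\<And>y. L * (\<Sum>i<n. (y i)\<^sup>2) \<le> (\<Sum>i<n. \<Sum>j<n. a i j * y i * y j)) \<Longrightarrow> L \<le> lambda_min A"
proof -
  define E where "E = {x. eigenvalue A (complex_of_real x)}"
  have fin: "finite E" unfolding E_def by (rule finite_real_eigenvalues[of A n]) (simp add: A_def)
  obtain \<mu> x where x: "\<exists>i<n. x i \<noteq> 0" "\<And>i. i < n \<Longrightarrow> (\<Sum>j<n. a i j * x j) = \<mu> * x i"
    and min: "\<And>y. \<mu> * (\<Sum>i<n. (y i)\<^sup>2) \<le> (\<Sum>i<n. \<Sum>j<n. a i j * y i * y j)"
    using rayleigh_minimizer[of n a] n sym by blast
  have \<mu>: "\<mu> \<in> E" unfolding E_def A_def mem_Collect_eq eigenvalue_real_mat using x by blast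
  then have "lambda_min A \<le> \<mu>" unfolding lambda_min_def E_def[symmetric] using fin by simp
  then have "lambda_min A * (\<Sum>i<n. (y i)\<^sup>2) \<le> \<mu> * (\<Sum>i<n. (y i)\<^sup>2)" for y
    by (intro mult_right_mono sum_nonneg) auto
  then show "lambda_min A * (\<Sum>i<n. (y i)\<^sup>2) \<le> (\<Sum>i<n. \<Sum>j<n. a i j * y i * y j)" for y
    using min order_trans by blast
  fix L assume L: "\<And>y. L * (\<Sum>i<n. (y i)\<^sup>2) \<le> (\<Sum>i<n. \<Sum>j<n. a i j * y i * y j)"
  have "L \<le> e" if "e \<in> E" for e
  proof -
    from that obtain y i where y: "i < n" "y i \<noteq> 0" "\<And>i. i < n \<Longrightarrow> (\<Sum>j<n. a i j * y j) = e * y i"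
      unfolding E_def A_def mem_Collect_eq eigenvalue_real_mat by blast
    have "(\<Sum>i<n. \<Sum>j<n. a i j * y i * y j) = (\<Sum>i<n. y i * (\<Sum>j<n. a i j * y j))"
      by (simp add: sum_distrib_left algebra_simps)
    also have "\<dots> = (\<Sum>i<n. y i * (e * y i))"
      by (intro sum.cong refl arg_cong2[of _ _ _ _ "(*)"] y(3)) simp
    also have "\<dots> = e * (\<Sum>i<n. (y i)\<^sup>2)"
      by (simp add: sum_distrib_left power2_eq_square algebra_simps)
    finally have "L * (\<Sum>i<n. (y i)\<^sup>2) \<le> e * (\<Sum>i<n. (y i)\<^sup>2)" using L[of y] by simp
    moreover have "(\<Sum>i<n. (y i)\<^sup>2) > 0"
      using y(1,2) by (intro sum_pos2[of _ i]) auto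
    ultimately show ?thesis by simp
  qed
  then show "L \<le> lambda_min A"
    unfolding lambda_min_def E_def[symmetric] using fin \<mu> by (intro Min.boundedI) auto
qed

section \<open>Orthogonal systems\<close>

lemma two_mult_le_add:
  fixes u v z :: real
  assumes "z\<^sup>2 \<le> u * v" "u \<ge> 0" "v \<ge> 0"
  shows "2 * z \<le> u + v"
proof (rule power2_le_imp_le)
  have "(2 * z)\<^sup>2 \<le> 4 * (u * v)" using assms(1) by (simp add: power2_eq_square)
  also have "\<dots> = (u + v)\<^sup>2 - (u - v)\<^sup>2" by (simp add: power2_eq_square algebra_simps)
  also have "\<dots> \<le> (u + v)\<^sup>2" by simp
  finally show "(2 * z)\<^sup>2 \<le> (u + v)\<^sup>2" .
qed (use assms in simp)

text \<open>
  The last factor is the trace of the inverse of \<open>a\<close>, written in terms of an orthogonal system.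
\<close>

lemma orthogonal_system_bound:
  fixes a p :: "nat \<Rightarrow> nat \<Rightarrow> real" and h :: "nat \<Rightarrow> real"
  assumes sym: "\<And>i j. a i j = a j i"
    and diag: "\<And>n. p n n \<noteq> 0"
    and orth: "\<And>n j. j < n \<Longrightarrow> (\<Sum>k\<le>n. a j k * p n k) = 0"
    and h: "\<And>n. p n n * (\<Sum>k\<le>n. a n k * p n k) = h n" "\<And>n. h n > 0"
  shows "(\<Sum>i\<le>N. (x i)\<^sup>2) \<le> (\<Sum>i\<le>N. \<Sum>j\<le>N. a i j * x i * x j) * (\<Sum>n\<le>N. (\<Sum>k\<le>n. (p n k)\<^sup>2) / h n)"
proof (induction N arbitrary: x)
  case 0
  have "a 0 0 * (p 0 0)\<^sup>2 = h 0"
    using h(1)[of 0] by (simp add: power2_eq_square algebra_simps)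
  then have "a 0 0 * x 0 * x 0 * ((p 0 0)\<^sup>2 / h 0) = (x 0)\<^sup>2 * (h 0 / h 0)"
    by (simp add: power2_eq_square algebra_simps)
  also have "\<dots> = (x 0)\<^sup>2" using h(2)[of 0] by simp
  finally have "a 0 0 * x 0 * x 0 * ((p 0 0)\<^sup>2 / h 0) = (x 0)\<^sup>2" .
  then show ?case by simp
next
  case (Suc N)
  let ?n = "Suc N"
  \<comment> \<open>With this multiple of the last row subtracted, \<open>y\<close> has last entry
    0. The induction hypothesis therefore controls it, and it is orthogonal to \<open>q\<close> with
    respect to the form.\<close>
  define c where "c = x ?n / p ?n ?n"
  define q where "q = p ?n"
  define y where "y = (\<lambda>i. x i - c * q i)"
  define S where "S = (\<Sum>n\<le>N. (\<Sum>k\<le>n. (p n k)\<^sup>2) / h n)"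
  define Y where "Y = (\<Sum>i\<le>?n. (y i)\<^sup>2)"
  define P where "P = (\<Sum>i\<le>?n. (q i)\<^sup>2)"
  define Q where "Q = (\<Sum>i\<le>?n. \<Sum>j\<le>?n. a i j * y i * y j)"
  define z where "z = (\<Sum>i\<le>?n. y i * q i)"
  have yn: "y ?n = 0" using diag[of ?n] by (simp add: y_def c_def q_def)
  have x: "x i = y i + c * q i" for i by (simp add: y_def)
  have "S > 0"
    unfolding S_def using h(2) diag by (intro sum_pos2[of _ 0] divide_nonneg_pos sum_nonneg) auto
  have YQS: "Y \<le> Q * S"
    using Suc.IH[of y] by (simp add: Y_def Q_def S_def yn)
  have "Y \<ge> 0" unfolding Y_def by (intro sum_nonneg) auto
  then have "0 \<le> Q * S" using YQS by simp
  then have "Q \<ge> 0" using \<open>S > 0\<close> by (simp add: zero_le_mult_iff)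
  have "P \<ge> 0" unfolding P_def by (intro sum_nonneg) auto
  have Tq: "(\<Sum>j\<le>?n. a i j * q j) = 0" if "i < ?n" for i
    using orth[OF that] by (simp add: q_def)
  have yTq: "(\<Sum>i\<le>?n. \<Sum>j\<le>?n. a i j * y i * q j) = 0"
  proof -
    have "(\<Sum>j\<le>?n. a i j * y i * q j) = 0" if "i \<le> ?n" for i
    proof -
      have "(\<Sum>j\<le>?n. a i j * y i * q j) = y i * (\<Sum>j\<le>?n. a i j * q j)"
        by (simp only: sum_distrib_left mult_ac)
      then show ?thesis using that Tq yn by (cases "i = ?n") auto
    qed
    then show ?thesis by (intro sum.neutral) auto
  qed
  have qTy: "(\<Sum>i\<le>?n. \<Sum>j\<le>?n. a i j * q i * y j) = 0"
    by (subst sum.swap, subst yTq[symmetric]) (simp only: sym mult_ac)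
  have qTq: "(\<Sum>i\<le>?n. \<Sum>j\<le>?n. a i j * q i * q j) = h ?n"
  proof -
    have "(\<Sum>i\<le>?n. \<Sum>j\<le>?n. a i j * q i * q j) = (\<Sum>i\<le>?n. q i * (\<Sum>j\<le>?n. a i j * q j))"
      by (simp only: sum_distrib_left mult_ac)
    also have "\<dots> = (\<Sum>i\<le>N. q i * (\<Sum>j\<le>?n. a i j * q j)) + q ?n * (\<Sum>j\<le>?n. a ?n j * q j)"
      by (rule sum.atMost_Suc)
    also have "(\<Sum>i\<le>N. q i * (\<Sum>j\<le>?n. a i j * q j)) = 0"
      by (intro sum.neutral ballI) (simp only: Tq atMost_iff less_Suc_eq_le mult_zero_right)
    also have "0 + q ?n * (\<Sum>j\<le>?n. a ?n j * q j) = h ?n"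
      using h(1)[of ?n] by (simp only: q_def add_0)
    finally show ?thesis .
  qed
  have Qx: "(\<Sum>i\<le>?n. \<Sum>j\<le>?n. a i j * x i * x j) = Q + c\<^sup>2 * h ?n"
  proof -
    have "(\<Sum>i\<le>?n. \<Sum>j\<le>?n. a i j * x i * x j) = (\<Sum>i\<le>?n. \<Sum>j\<le>?n. a i j * y i * y j
        + c * (a i j * y i * q j) + c * (a i j * q i * y j) + c\<^sup>2 * (a i j * q i * q j))"
      by (intro sum.cong refl) (simp add: x algebra_simps power2_eq_square)
    also have "\<dots> = Q + c * (\<Sum>i\<le>?n. \<Sum>j\<le>?n. a i j * y i * q j)
        + c * (\<Sum>i\<le>?n. \<Sum>j\<le>?n. a i j * q i * y j) + c\<^sup>2 * (\<Sum>i\<le>?n. \<Sum>j\<le>?n. a i j * q i * q j)"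
      by (simp only: Q_def sum_distrib_left sum.distrib)
    also have "\<dots> = Q + c\<^sup>2 * h ?n"
      by (simp only: yTq qTy qTq mult_zero_right add_0_right)
    finally show ?thesis .
  qed
  have Sx: "(\<Sum>i\<le>?n. (x i)\<^sup>2) = Y + 2 * (c * z) + c\<^sup>2 * P"
  proof -
    have "(\<Sum>i\<le>?n. (x i)\<^sup>2) = (\<Sum>i\<le>?n. (y i)\<^sup>2 + 2 * (c * (y i * q i)) + c\<^sup>2 * (q i)\<^sup>2)"
      by (intro sum.cong refl) (simp add: x algebra_simps power2_eq_square)
    then show ?thesis by (simp only: Y_def z_def P_def sum_distrib_left sum.distrib)
  qed
  \<comment> \<open>The right side consists of the two mixed terms in the expansion of (Q + c^2 h)(S
    + P/h). Their product is c^2 Q S P, which dominates (c z)^2 by Cauchy-Schwarz and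
    \<open>YQS\<close>.\<close>
  have "2 * (c * z) \<le> Q * P / h ?n + c\<^sup>2 * h ?n * S"
  proof (rule two_mult_le_add)
    have "(c * z)\<^sup>2 \<le> c\<^sup>2 * (Y * P)"
      unfolding power_mult_distrib z_def Y_def P_def
      by (intro mult_left_mono Cauchy_Schwarz_ineq_sum) auto
    also have "\<dots> \<le> c\<^sup>2 * (Q * S * P)"
      using YQS \<open>P \<ge> 0\<close> by (intro mult_left_mono mult_right_mono) auto
    also have "\<dots> = Q * P / h ?n * (c\<^sup>2 * h ?n * S)"
      using h(2)[of ?n] by simp
    finally show "(c * z)\<^sup>2 \<le> Q * P / h ?n * (c\<^sup>2 * h ?n * S)" .
    show "0 \<le> Q * P / h ?n" "0 \<le> c\<^sup>2 * h ?n * S"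
      using \<open>Q \<ge> 0\<close> \<open>P \<ge> 0\<close> \<open>S > 0\<close> h(2)[of ?n] by auto
  qed
  then have "(\<Sum>i\<le>?n. (x i)\<^sup>2) \<le> Q * S + (Q * P / h ?n + c\<^sup>2 * h ?n * S) + c\<^sup>2 * P"
    unfolding Sx using YQS by linarith
  also have "\<dots> = (Q + c\<^sup>2 * h ?n) * (S + P / h ?n)"
    using h(2)[of ?n] by (simp add: field_simps)
  also have "S + P / h ?n = (\<Sum>n\<le>?n. (\<Sum>k\<le>n. (p n k)\<^sup>2) / h n)"
    by (simp add: S_def P_def q_def)
  finally show ?case unfolding Qx .
qed

text \<open>
  Row \<open>n\<close> lists the coefficients of a multiple of the \<open>n\<close>-th orthogonal polynomial on the unit circle for
  the weight \<open>|1 - z|\<^bsup>2\<alpha>\<^esup>\<close>.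
\<close>

definition orth_poly_coeff :: "real \<Rightarrow> nat \<Rightarrow> nat \<Rightarrow> real" where
  "orth_poly_coeff \<alpha> n k = pochhammer (\<alpha> + 1) k / fact k * (pochhammer \<alpha> (n - k) / fact (n - k))"

text \<open>The numbers (\<alpha>+1)_m / m! are the partial sums of (\<alpha>)_m / m!, so
  differencing in n lowers the parameter of the second factor by one.\<close>

lemma orth_poly_coeff_eq_torsion_diff:
  assumes "k \<le> n" "n > 0"
  shows "orth_poly_coeff \<alpha> n k = torsion \<alpha> n k - torsion \<alpha> (n - 1) k"
proof (cases "k = n")
  case True
  then show ?thesis using assms by (simp add: orth_poly_coeff_def torsion_def)
next
  case False
  then obtain m where m: "n - k = Suc m" using assms by (metis Suc_diff_Suc le_neq_implies_less)
  then have m': "n - 1 - k = m" by simp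
  have "pochhammer (\<alpha> + 1) m / fact m = pochhammer (\<alpha> + 1) m * real (Suc m) / fact (Suc m)"
    by (simp del: of_nat_Suc)
  then have "pochhammer (\<alpha> + 1) (Suc m) / fact (Suc m) - pochhammer (\<alpha> + 1) m / fact m
      = (pochhammer (\<alpha> + 1) m * (\<alpha> + 1 + real m) - pochhammer (\<alpha> + 1) m * real (Suc m)) / fact (Suc m)"
    by (simp only: pochhammer_Suc diff_divide_distrib)
  also have "\<dots> = pochhammer \<alpha> (Suc m) / fact (Suc m)"
    by (simp add: pochhammer_rec algebra_simps)
  finally have "pochhammer \<alpha> (Suc m) / fact (Suc m)
      = pochhammer (\<alpha> + 1) (Suc m) / fact (Suc m) - pochhammer (\<alpha> + 1) m / fact m" ..
  moreover have "k \<le> n - 1" using m by simp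
  ultimately show ?thesis
    using assms unfolding orth_poly_coeff_def torsion_def m m'
    by (simp only: if_True right_diff_distrib)
qed

text \<open>In each row j < n the vectors \<open>torsion \<alpha> n\<close> and
  \<open>torsion \<alpha> (n - 1)\<close> both produce \<open>symb_coeff \<alpha> 0\<close>, so
  their difference produces 0.\<close>

lemma orth_poly_coeff_orthogonal:
  assumes \<alpha>: "\<alpha> > 0" and "j < n"
  shows "(\<Sum>k\<le>n. symb_coeff \<alpha> (int j - int k) * orth_poly_coeff \<alpha> n k) = 0"
proof -
  obtain m where n: "n = Suc m" using assms(2) by (cases n) auto
  have "(\<Sum>k\<le>n. symb_coeff \<alpha> (int j - int k) * orth_poly_coeff \<alpha> n k)
      = (\<Sum>k\<le>n. symb_coeff \<alpha> (int j - int k) * torsion \<alpha> n k) - (\<Sum>k\<le>n. symb_coeff \<alpha> (int j - int k) * torsion \<alpha> m k)"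
    unfolding sum_subtractf[symmetric]
    by (intro sum.cong refl) (simp add: n orth_poly_coeff_eq_torsion_diff right_diff_distrib)
  \<comment> \<open>The default value 0 of \<open>torsion\<close> at k = n = m + 1 removes the extra
    summand.\<close>
  also have "(\<Sum>k\<le>n. symb_coeff \<alpha> (int j - int k) * torsion \<alpha> m k) = symb_coeff \<alpha> 0"
    using symb_coeff_torsion[OF \<alpha>, of j m] assms(2) by (simp add: n torsion_def[of _ _ "Suc _"])
  also have "(\<Sum>k\<le>n. symb_coeff \<alpha> (int j - int k) * torsion \<alpha> n k) = symb_coeff \<alpha> 0"
    using symb_coeff_torsion[OF \<alpha>, of j n] assms(2) by simp
  finally show ?thesis by simp
qed

text \<open>Pair the image of the orthogonal row with the torsion vector in two ways. Orthogonality
  leaves only the last entry, where both vectors agree; moving the symmetric matrix onto the torsion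
  vector gives a constant times the sum of the row, a Vandermonde convolution.\<close>

lemma orth_poly_coeff_norm:
  assumes \<alpha>: "\<alpha> > 0"
  shows "orth_poly_coeff \<alpha> n n * (\<Sum>k\<le>n. symb_coeff \<alpha> (int n - int k) * orth_poly_coeff \<alpha> n k)
    = symb_coeff \<alpha> 0 * (pochhammer (2 * \<alpha> + 1) n / fact n)"
proof -
  let ?p = "orth_poly_coeff \<alpha> n" and ?t = "\<lambda>j k. symb_coeff \<alpha> (int j - int k)"
  have "(\<Sum>j\<le>n. torsion \<alpha> n j * (\<Sum>k\<le>n. ?t j k * ?p k)) = (\<Sum>j\<le>n. if j = n then ?p n * (\<Sum>k\<le>n. ?t n k * ?p k) else 0)"
    by (intro sum.cong refl)
      (auto simp: orth_poly_coeff_orthogonal[OF \<alpha>] orth_poly_coeff_def[of _ n n] torsion_def)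
  also have "\<dots> = ?p n * (\<Sum>k\<le>n. ?t n k * ?p k)" by simp
  finally have "?p n * (\<Sum>k\<le>n. ?t n k * ?p k) = (\<Sum>j\<le>n. \<Sum>k\<le>n. torsion \<alpha> n j * (?t j k * ?p k))"
    by (simp only: sum_distrib_left)
  also have "\<dots> = (\<Sum>k\<le>n. \<Sum>j\<le>n. torsion \<alpha> n j * (?t j k * ?p k))" by (rule sum.swap)
  also have "\<dots> = (\<Sum>k\<le>n. ?p k * symb_coeff \<alpha> 0)"
  proof (intro sum.cong refl)
    fix k assume "k \<in> {..n}"
    then have "(\<Sum>j\<le>n. ?t k j * torsion \<alpha> n j) = symb_coeff \<alpha> 0"
      using symb_coeff_torsion[OF \<alpha>] by simp
    moreover have "?t j k = ?t k j" for j using symb_coeff_minus[of \<alpha> "int j - int k"] by simp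
    then have "(\<Sum>j\<le>n. torsion \<alpha> n j * (?t j k * ?p k)) = ?p k * (\<Sum>j\<le>n. ?t k j * torsion \<alpha> n j)"
      unfolding sum_distrib_left by (intro sum.cong refl) (simp add: mult_ac)
    ultimately show "(\<Sum>j\<le>n. torsion \<alpha> n j * (?t j k * ?p k)) = ?p k * symb_coeff \<alpha> 0"
      by simp
  qed
  also have "\<dots> = (\<Sum>k\<le>n. ?p k) * symb_coeff \<alpha> 0" by (simp only: sum_distrib_right)
  also have "(\<Sum>k\<le>n. ?p k) = pochhammer (2 * \<alpha> + 1) n / fact n"
    unfolding orth_poly_coeff_def pochhammer_div_fact_convolution by (simp add: algebra_simps)
  finally show ?thesis by (simp only: mult_ac)
qed

section \<open>Pochhammer quotients\<close>

text \<open>Euler's limit formula for Gamma, read backwards; a fixed shift s of the index does not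
  affect the limit.\<close>

lemma pochhammer_over_fact_asymp:
  fixes a :: real
  assumes a: "a > 0"
  shows "(\<lambda>n. pochhammer a (n + s) / fact (n + s) / real n powr (a - 1)) \<longlonglongrightarrow> 1 / Gamma a"
proof -
  have "Gamma a \<noteq> 0" using Gamma_real_pos[OF a] by simp
  then have "(\<lambda>n. inverse (Gamma_series' a n)) \<longlonglongrightarrow> inverse (Gamma a)"
    by (intro tendsto_inverse Gamma_series'_LIMSEQ)
  moreover have "\<forall>\<^sub>F n in sequentially. inverse (Gamma_series' a n) = pochhammer a n / fact n / real n powr (a - 1)"
    using eventually_gt_at_top[of 0]
  proof eventually_elim
    case (elim n)
    then have "fact n = real n * fact (n - 1)" by (simp add: fact_reduce)
    then show ?case using elim
      by (simp add: Gamma_series'_def powr_diff) (simp add: powr_def mult.commute)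
  qed
  ultimately have "(\<lambda>n. pochhammer a n / fact n / real n powr (a - 1)) \<longlonglongrightarrow> inverse (Gamma a)"
    by (rule Lim_transform_eventually)
  then have "(\<lambda>n. pochhammer a (n + s) / fact (n + s) / real (n + s) powr (a - 1)) \<longlonglongrightarrow> inverse (Gamma a)"
    by (rule LIMSEQ_ignore_initial_segment)
  moreover have "(\<lambda>n. real (n + s) powr (a - 1) / real n powr (a - 1)) \<longlonglongrightarrow> 1"
    by real_asymp
  ultimately have "(\<lambda>n. pochhammer a (n + s) / fact (n + s) / real (n + s) powr (a - 1) *
      (real (n + s) powr (a - 1) / real n powr (a - 1))) \<longlonglongrightarrow> inverse (Gamma a) * 1"
    by (rule tendsto_mult)
  moreover have "\<forall>\<^sub>F n in sequentially. pochhammer a (n + s) / fact (n + s) / real (n + s) powr (a - 1) *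
      (real (n + s) powr (a - 1) / real n powr (a - 1)) = pochhammer a (n + s) / fact (n + s) / real n powr (a - 1)"
    using eventually_gt_at_top[of 0] by eventually_elim auto
  ultimately show ?thesis
    using Lim_transform_eventually by (fastforce simp: inverse_eq_divide)
qed

text \<open>The parameter 2a - 1 is the one for which the growth orders agree: 2(a - 1) = (2a - 1) -
  1.\<close>

lemma square_pochhammer_ratio_LIMSEQ:
  fixes a :: real
  assumes a: "a > 1 / 2"
  shows "(\<lambda>n. (pochhammer a (n + s) / fact (n + s))\<^sup>2 / (pochhammer (2 * a - 1) n / fact n))
    \<longlonglongrightarrow> Gamma (2 * a - 1) / (Gamma a)\<^sup>2"
proof -
  have pos: "Gamma a > 0" "Gamma (2 * a - 1) > 0" using a by (auto intro!: Gamma_real_pos)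
  have "(\<lambda>n. (pochhammer a (n + s) / fact (n + s) / real n powr (a - 1))\<^sup>2 /
      (pochhammer (2 * a - 1) (n + 0) / fact (n + 0) / real n powr (2 * a - 1 - 1)))
      \<longlonglongrightarrow> (1 / Gamma a)\<^sup>2 / (1 / Gamma (2 * a - 1))"
  proof (intro tendsto_divide[OF tendsto_power])
    show "(\<lambda>n. pochhammer a (n + s) / fact (n + s) / real n powr (a - 1)) \<longlonglongrightarrow> 1 / Gamma a"
      using a by (intro pochhammer_over_fact_asymp) simp
    show "(\<lambda>n. pochhammer (2 * a - 1) (n + 0) / fact (n + 0) / real n powr (2 * a - 1 - 1)) \<longlonglongrightarrow> 1 / Gamma (2 * a - 1)"
      using a by (intro pochhammer_over_fact_asymp) simp
  qed (use pos in simp)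
  moreover have "\<forall>\<^sub>F n in sequentially. (pochhammer a (n + s) / fact (n + s) / real n powr (a - 1))\<^sup>2 /
      (pochhammer (2 * a - 1) (n + 0) / fact (n + 0) / real n powr (2 * a - 1 - 1))
      = (pochhammer a (n + s) / fact (n + s))\<^sup>2 / (pochhammer (2 * a - 1) n / fact n)"
    using eventually_gt_at_top[of 0]
  proof eventually_elim
    case (elim n)
    have "(real n powr (a - 1))\<^sup>2 = real n powr (2 * a - 1 - 1)"
      using elim by (simp add: powr_power algebra_simps)
    then show ?case using elim by (simp add: power_divide power_mult_distrib)
  qed
  ultimately have "(\<lambda>n. (pochhammer a (n + s) / fact (n + s))\<^sup>2 / (pochhammer (2 * a - 1) n / fact n))
      \<longlonglongrightarrow> (1 / Gamma a)\<^sup>2 / (1 / Gamma (2 * a - 1))"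
    by (rule Lim_transform_eventually)
  then show ?thesis by (simp add: power_divide)
qed

text \<open>The quotient of the two sides increases in n, since (a + n)^2 - (n + 1)(2a - 1 + n) = (a
  - 1)^2 is nonnegative, and hence stays below its limit.\<close>

lemma square_pochhammer_le:
  fixes a :: real
  assumes a: "a > 1 / 2"
  shows "(pochhammer a n / fact n)\<^sup>2 \<le> Gamma (2 * a - 1) / (Gamma a)\<^sup>2 * (pochhammer (2 * a - 1) n / fact n)"
proof -
  define r where "r = (\<lambda>n. (pochhammer a n / fact n)\<^sup>2 / (pochhammer (2 * a - 1) n / fact n))"
  have pos: "pochhammer a n > 0" "pochhammer (2 * a - 1) n > 0" for n
    using a by (auto intro!: pochhammer_pos)
  have "r n \<le> r (Suc n)" for n
  proof -
    have eq: "r (Suc n) = r n * ((a + n)\<^sup>2 / ((real n + 1) * (2 * a - 1 + n)))"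
      using a pos[of n] by (simp add: r_def pochhammer_Suc divide_simps) (simp add: power2_eq_square algebra_simps)
    have "(real n + 1) * (2 * a - 1 + n) \<le> (a + n)\<^sup>2"
      using zero_le_power2[of "a - 1"] by (simp add: power2_eq_square algebra_simps)
    then have "1 \<le> (a + n)\<^sup>2 / ((real n + 1) * (2 * a - 1 + n))"
      using a by (subst le_divide_eq_1_pos) (auto intro!: mult_pos_pos)
    moreover have "r n \<ge> 0" using pos[of n] by (simp add: r_def)
    ultimately show ?thesis unfolding eq by (metis mult.right_neutral mult_left_mono)
  qed
  then have "incseq r" by (rule incseq_SucI)
  moreover have "r \<longlonglongrightarrow> Gamma (2 * a - 1) / (Gamma a)\<^sup>2"
    using square_pochhammer_ratio_LIMSEQ[OF a, of 0] by (simp add: r_def)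
  ultimately have "r n \<le> Gamma (2 * a - 1) / (Gamma a)\<^sup>2" by (rule incseq_le)
  moreover have "pochhammer (2 * a - 1) n / fact n > 0" using pos(2) by simp
  ultimately show ?thesis unfolding r_def by (simp only: pos_divide_le_eq)
qed

text \<open>
  The shift by \<open>s\<close> reverses the monotonicity of the quotient without changing its limit.
\<close>

lemma square_pochhammer_shift_ge:
  fixes a :: real
  assumes a: "a \<ge> 1" and s: "real s \<ge> (a - 1) / 2"
  shows "Gamma (2 * a - 1) / (Gamma a)\<^sup>2 * (pochhammer (2 * a - 1) n / fact n) \<le> (pochhammer a (n + s) / fact (n + s))\<^sup>2"
proof -
  define r where "r = (\<lambda>n. (pochhammer a (n + s) / fact (n + s))\<^sup>2 / (pochhammer (2 * a - 1) n / fact n))"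
  have pos: "pochhammer a n > 0" "pochhammer (2 * a - 1) n > 0" for n
    using a by (auto intro!: pochhammer_pos)
  have "r (Suc n) \<le> r n" for n
  proof -
    have eq: "r (Suc n) = r n * ((a + n + s)\<^sup>2 * (real n + 1) / ((real n + s + 1)\<^sup>2 * (2 * a - 1 + n)))"
      using a pos[of n] pos[of "n + s"]
      by (simp add: r_def pochhammer_Suc divide_simps) (simp add: power2_eq_square algebra_simps)
    \<comment> \<open>In terms of x and b = a - 1 the needed inequality is (x + b)^2 (x - s) \<le>
      x^2 (x - s + 2b). The difference of its sides is b x (2s - b) + b^2 s, which is where s \<ge>
      b/2 enters.\<close>
    define x where "x = real n + s + 1"
    define b where "b = a - 1"
    have x: "x > 0" by (simp add: x_def)
    have bs: "b \<ge> 0" "2 * real s - b \<ge> 0" using a s by (auto simp: b_def)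
    have "0 \<le> b * (x * (2 * real s - b)) + b\<^sup>2 * real s"
      using x bs by (intro add_nonneg_nonneg mult_nonneg_nonneg) auto
    then have "(x + b)\<^sup>2 * (x - real s) \<le> x\<^sup>2 * (x - real s + 2 * b)"
      by (simp add: power2_eq_square algebra_simps)
    then have "(a + n + s)\<^sup>2 * (real n + 1) \<le> (real n + s + 1)\<^sup>2 * (2 * a - 1 + n)"
      by (simp add: x_def b_def algebra_simps)
    moreover have "(real n + s + 1)\<^sup>2 * (2 * a - 1 + n) > 0"
      using a by (intro mult_pos_pos) auto
    ultimately have "(a + n + s)\<^sup>2 * (real n + 1) / ((real n + s + 1)\<^sup>2 * (2 * a - 1 + n)) \<le> 1"
      by (subst divide_le_eq_1_pos)
    moreover have "r n \<ge> 0" using pos[of n] by (simp add: r_def)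
    ultimately show ?thesis unfolding eq by (metis mult.right_neutral mult_left_mono)
  qed
  then have "decseq r" by (rule decseq_SucI)
  moreover have "r \<longlonglongrightarrow> Gamma (2 * a - 1) / (Gamma a)\<^sup>2"
    unfolding r_def using a by (intro square_pochhammer_ratio_LIMSEQ) simp
  ultimately have "Gamma (2 * a - 1) / (Gamma a)\<^sup>2 \<le> r n" by (rule decseq_ge)
  moreover have "pochhammer (2 * a - 1) n / fact n > 0" using pos(2) by simp
  ultimately show ?thesis unfolding r_def by (simp only: pos_le_divide_eq)
qed

text \<open>The sum telescopes: for n > 0, (a)_(n+1) / (b)_n - (a)_n / (b)_(n-1) is (a - b + 1)
  times the n-th summand.\<close>

lemma sum_pochhammer_ratio:
  fixes a b :: real
  assumes b: "b > 0" and ab: "a - b + 1 \<noteq> 0"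
  shows "(\<Sum>n\<le>N. pochhammer a n / pochhammer b n)
    = (pochhammer a (Suc N) / pochhammer b N - (b - 1)) / (a - b + 1)"
proof (induction N)
  case 0
  then show ?case using ab by (simp add: field_simps)
next
  case (Suc N)
  have "pochhammer b N > 0" "b + real N > 0" using b by (auto intro!: pochhammer_pos)
  define X where "X = pochhammer a (Suc N) / pochhammer b (Suc N)"
  have 1: "pochhammer a (Suc N) / pochhammer b N = X * (b + real N)"
    using \<open>pochhammer b N > 0\<close> \<open>b + real N > 0\<close> by (simp add: X_def pochhammer_Suc)
  have 2: "pochhammer a (Suc (Suc N)) / pochhammer b (Suc N) = X * (a + real N + 1)"
    by (simp add: X_def pochhammer_Suc[of a "Suc N"] algebra_simps)
  show ?case
    unfolding sum.atMost_Suc Suc.IH 1 2 X_def[symmetric] using ab by (simp add: field_simps)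
qed

section \<open>Bounds for the smallest eigenvalue\<close>

lemma toeplitz_symbol:
  assumes "\<alpha> > 1 / 2"
  shows "toeplitz N (\<lambda>z. complex_of_real (cmod (1 - z) powr (2 * \<alpha>)))
    = Matrix.mat (Suc N) (Suc N) (\<lambda>(i, j). complex_of_real (symb_coeff \<alpha> (int i - int j)))"
proof (rule eq_matI)
  fix i j assume "i < dim_row (Matrix.mat (Suc N) (Suc N) (\<lambda>(i, j). complex_of_real (symb_coeff \<alpha> (int i - int j))))"
    "j < dim_col (Matrix.mat (Suc N) (Suc N) (\<lambda>(i, j). complex_of_real (symb_coeff \<alpha> (int i - int j))))"
  then show "toeplitz N (\<lambda>z. complex_of_real (cmod (1 - z) powr (2 * \<alpha>))) $$ (i, j)
    = Matrix.mat (Suc N) (Suc N) (\<lambda>(i, j). complex_of_real (symb_coeff \<alpha> (int i - int j))) $$ (i, j)"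
    by (simp add: toeplitz_def fourier_coeff_symbol[OF assms] symb_coeff_sym[of _ j])
qed (simp_all add: toeplitz_def)

abbreviation symbol_toeplitz :: "real \<Rightarrow> nat \<Rightarrow> complex Matrix.mat" where
  "symbol_toeplitz \<alpha> N \<equiv> toeplitz N (\<lambda>z. complex_of_real (cmod (1 - z) powr (2 * \<alpha>)))"

lemma symb_coeff_0_pos:
  assumes "\<alpha> > 0"
  shows "symb_coeff \<alpha> 0 > 0"
  using assms unfolding symb_coeff_0 by (intro divide_pos_pos zero_less_power Gamma_real_pos) auto

text \<open>\<open>square_pochhammer_le\<close> applied to both factors replaces the parameters
  \<alpha> + 1 and \<alpha> by 2\<alpha> + 1 and 2\<alpha> - 1. The resulting convolution has
  parameter 4\<alpha>.\<close>

lemma sum_square_orth_poly_coeff_le: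
  fixes \<alpha> :: real
  assumes "\<alpha> > 1 / 2"
  shows "(\<Sum>k\<le>n. (orth_poly_coeff \<alpha> n k)\<^sup>2)
    \<le> symb_coeff \<alpha> 0 * (Gamma (2 * \<alpha> - 1) / (Gamma \<alpha>)\<^sup>2) * (pochhammer (4 * \<alpha>) n / fact n)"
proof -
  let ?b = "\<lambda>k. pochhammer (2 * \<alpha> + 1) k / fact k" and ?d = "\<lambda>k. pochhammer (2 * \<alpha> - 1) k / fact k"
  let ?s = "Gamma (2 * \<alpha> - 1) / (Gamma \<alpha>)\<^sup>2"
  have t0: "Gamma (2 * \<alpha> + 1) / (Gamma (\<alpha> + 1))\<^sup>2 = symb_coeff \<alpha> 0" "2 * (\<alpha> + 1) - 1 = 2 * \<alpha> + 1"
    by (simp_all add: symb_coeff_0 algebra_simps)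
  have "(\<Sum>k\<le>n. (orth_poly_coeff \<alpha> n k)\<^sup>2) \<le> (\<Sum>k\<le>n. symb_coeff \<alpha> 0 * ?s * (?b k * ?d (n - k)))"
  proof (rule sum_mono)
    fix k
    have "(pochhammer (\<alpha> + 1) k / fact k)\<^sup>2 \<le> symb_coeff \<alpha> 0 * ?b k"
      using square_pochhammer_le[of "\<alpha> + 1" k] assms unfolding t0(2) t0(1) by simp
    moreover have "(pochhammer \<alpha> (n - k) / fact (n - k))\<^sup>2 \<le> ?s * ?d (n - k)"
      using square_pochhammer_le[of \<alpha> "n - k"] assms by simp
    ultimately have "(orth_poly_coeff \<alpha> n k)\<^sup>2 \<le> (symb_coeff \<alpha> 0 * ?b k) * (?s * ?d (n - k))"
      unfolding orth_poly_coeff_def power_mult_distrib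
      by (intro mult_mono order_trans[OF zero_le_power2]) auto
    then show "(orth_poly_coeff \<alpha> n k)\<^sup>2 \<le> symb_coeff \<alpha> 0 * ?s * (?b k * ?d (n - k))"
      by (simp only: mult_ac)
  qed
  also have "\<dots> = symb_coeff \<alpha> 0 * ?s * (pochhammer (4 * \<alpha>) n / fact n)"
    unfolding sum_distrib_left[symmetric] pochhammer_div_fact_convolution by simp
  finally show ?thesis .
qed

lemma lambda_min_symbol_lower:
  fixes \<alpha> :: real
  assumes \<alpha>: "\<alpha> > 1 / 2"
  shows "2 * \<alpha> * (Gamma \<alpha>)\<^sup>2 / Gamma (2 * \<alpha> - 1) * (pochhammer (2 * \<alpha> + 1) N / pochhammer (4 * \<alpha>) (Suc N))
    \<le> lambda_min (symbol_toeplitz \<alpha> N)"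
proof -
  define s where "s = Gamma (2 * \<alpha> - 1) / (Gamma \<alpha>)\<^sup>2"
  define h where "h = (\<lambda>n. symb_coeff \<alpha> 0 * (pochhammer (2 * \<alpha> + 1) n / fact n))"
  define S where "S = (\<Sum>n\<le>N. (\<Sum>k\<le>n. (orth_poly_coeff \<alpha> n k)\<^sup>2) / h n)"
  \<comment> \<open>Closed form of the majorant of the inverse trace \<open>S\<close>, with the
    negative boundary term of the telescoping sum dropped.\<close>
  define S' where "S' = s * (pochhammer (4 * \<alpha>) (Suc N) / pochhammer (2 * \<alpha> + 1) N) / (2 * \<alpha>)"
  have t0: "symb_coeff \<alpha> 0 > 0" using \<alpha> by (intro symb_coeff_0_pos) simp
  have "Gamma (2 * \<alpha> - 1) > 0" "Gamma \<alpha> > 0" using \<alpha> by (auto intro!: Gamma_real_pos)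
  then have s: "s > 0" unfolding s_def by simp
  have poch: "pochhammer (2 * \<alpha> + 1) n > 0" "pochhammer (4 * \<alpha>) n > 0" "pochhammer (\<alpha> + 1) n > 0" for n
    using \<alpha> by (auto intro!: pochhammer_pos)
  have h: "h n > 0" for n using t0 poch by (simp add: h_def)
  have diag: "orth_poly_coeff \<alpha> n n \<noteq> 0" for n
    using poch(3)[of n] by (simp add: orth_poly_coeff_def)
  have "S \<le> (\<Sum>n\<le>N. s * (pochhammer (4 * \<alpha>) n / pochhammer (2 * \<alpha> + 1) n))"
    unfolding S_def
  proof (rule sum_mono)
    fix n
    have "(\<Sum>k\<le>n. (orth_poly_coeff \<alpha> n k)\<^sup>2) / h n \<le> symb_coeff \<alpha> 0 * s * (pochhammer (4 * \<alpha>) n / fact n) / h n"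
      using sum_square_orth_poly_coeff_le[OF \<alpha>, of n] h[of n]
      unfolding s_def by (intro divide_right_mono) auto
    also have "\<dots> = s * (pochhammer (4 * \<alpha>) n / pochhammer (2 * \<alpha> + 1) n)"
      using t0 poch(1)[of n] by (simp add: h_def)
    finally show "(\<Sum>k\<le>n. (orth_poly_coeff \<alpha> n k)\<^sup>2) / h n \<le> s * (pochhammer (4 * \<alpha>) n / pochhammer (2 * \<alpha> + 1) n)" .
  qed
  also have "\<dots> = s * ((pochhammer (4 * \<alpha>) (Suc N) / pochhammer (2 * \<alpha> + 1) N - 2 * \<alpha>) / (2 * \<alpha>))"
    using sum_pochhammer_ratio[of "2 * \<alpha> + 1" "4 * \<alpha>" N] \<alpha>
    unfolding sum_distrib_left[symmetric] by simp
  also have "\<dots> \<le> s * (pochhammer (4 * \<alpha>) (Suc N) / pochhammer (2 * \<alpha> + 1) N / (2 * \<alpha>))"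
    using s \<alpha> by (intro mult_left_mono divide_right_mono) auto
  finally have SS': "S \<le> S'" by (simp add: S'_def)
  have S: "S > 0"
    unfolding S_def using h diag[of 0] by (intro sum_pos2[of _ 0] divide_nonneg_pos sum_nonneg) auto
  then have S': "S' > 0" using SS' by linarith
  have "1 / S' \<le> lambda_min (symbol_toeplitz \<alpha> N)"
    unfolding toeplitz_symbol[OF \<alpha>]
  proof (rule lambda_min_ge)
    fix y :: "nat \<Rightarrow> real"
    define Q where "Q = (\<Sum>i\<le>N. \<Sum>j\<le>N. symb_coeff \<alpha> (int i - int j) * y i * y j)"
    have QS: "(\<Sum>i\<le>N. (y i)\<^sup>2) \<le> Q * S"
      unfolding Q_def S_def
    proof (rule orthogonal_system_bound)
      show "orth_poly_coeff \<alpha> n n * (\<Sum>k\<le>n. symb_coeff \<alpha> (int n - int k) * orth_poly_coeff \<alpha> n k) = h n" for n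
        unfolding h_def using \<alpha> by (intro orth_poly_coeff_norm) simp
      show "(\<Sum>k\<le>n. symb_coeff \<alpha> (int j - int k) * orth_poly_coeff \<alpha> n k) = 0" if "j < n" for n j
        using that \<alpha> by (intro orth_poly_coeff_orthogonal) simp
    qed (use diag h symb_coeff_sym in auto)
    have "0 \<le> (\<Sum>i\<le>N. (y i)\<^sup>2)" by (intro sum_nonneg) auto
    with QS have "0 \<le> Q * S" by simp
    then have "Q \<ge> 0" using S by (simp add: zero_le_mult_iff)
    then have "(\<Sum>i\<le>N. (y i)\<^sup>2) \<le> Q * S'"
      using QS SS' mult_left_mono[of S S' Q] by linarith
    then show "1 / S' * (\<Sum>i<Suc N. (y i)\<^sup>2) \<le> (\<Sum>i<Suc N. \<Sum>j<Suc N. symb_coeff \<alpha> (int i - int j) * y i * y j)"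
      unfolding lessThan_Suc_atMost Q_def[symmetric] using S' by (simp add: pos_divide_le_eq)
  qed (use symb_coeff_sym in auto)
  moreover have "1 / S' = 2 * \<alpha> * (Gamma \<alpha>)\<^sup>2 / Gamma (2 * \<alpha> - 1) * (pochhammer (2 * \<alpha> + 1) N / pochhammer (4 * \<alpha>) (Suc N))"
    by (simp add: S'_def s_def)
  ultimately show ?thesis by simp
qed

text \<open>Rayleigh quotient of the torsion vector. For a lower bound on its norm, s entries are
  discarded at each end; in the M + 1 remaining ones both factors have index shifted by s, so
  \<open>square_pochhammer_shift_ge\<close> applies with a = \<alpha> + 1.\<close>

lemma lambda_min_symbol_upper:
  fixes \<alpha> :: real
  assumes \<alpha>: "\<alpha> > 1 / 2" and s: "real s \<ge> \<alpha> / 2"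
  shows "lambda_min (symbol_toeplitz \<alpha> (M + 2 * s))
    \<le> (pochhammer (2 * \<alpha> + 2) (M + 2 * s) / fact (M + 2 * s)) / (symb_coeff \<alpha> 0 * (pochhammer (4 * \<alpha> + 2) M / fact M))"
proof -
  define N where "N = M + 2 * s"
  define v where "v = torsion \<alpha> N"
  define t where "t = symb_coeff \<alpha> 0"
  define X where "X = pochhammer (2 * \<alpha> + 2) N / fact N"
  define W where "W = pochhammer (4 * \<alpha> + 2) M / fact M"
  let ?a = "\<lambda>k. pochhammer (\<alpha> + 1) k / fact k" and ?b = "\<lambda>k. pochhammer (2 * \<alpha> + 1) k / fact k"
  have t: "t > 0" unfolding t_def using \<alpha> by (intro symb_coeff_0_pos) simp
  have X: "X \<ge> 0" and W: "W > 0" and b: "?b k > 0" for k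
    using \<alpha> by (auto simp: X_def W_def intro!: pochhammer_pos divide_pos_pos divide_nonneg_pos less_imp_le[OF pochhammer_pos])
  have "(\<Sum>i\<le>N. \<Sum>j\<le>N. symb_coeff \<alpha> (int i - int j) * v i * v j)
      = (\<Sum>i\<le>N. v i * (\<Sum>j\<le>N. symb_coeff \<alpha> (int i - int j) * torsion \<alpha> N j))"
    by (simp only: v_def sum_distrib_left mult_ac)
  also have "\<dots> = (\<Sum>i\<le>N. v i * t)"
    using \<alpha> by (intro sum.cong refl) (simp add: symb_coeff_torsion t_def)
  also have "\<dots> = t * X"
  proof -
    have "(\<Sum>i\<le>N. v i) = (\<Sum>i\<le>N. ?a i * ?a (N - i))"
      by (intro sum.cong) (auto simp: v_def torsion_def)
    also have "\<dots> = X" unfolding pochhammer_div_fact_convolution X_def by (simp add: algebra_simps)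
    finally show ?thesis by (simp add: sum_distrib_right[symmetric])
  qed
  finally have Q: "(\<Sum>i\<le>N. \<Sum>j\<le>N. symb_coeff \<alpha> (int i - int j) * v i * v j) = t * X" .
  have sq: "t * ?b k \<le> (?a (k + s))\<^sup>2" for k
  proof -
    have t0: "Gamma (2 * \<alpha> + 1) / (Gamma (\<alpha> + 1))\<^sup>2 = t" "2 * (\<alpha> + 1) - 1 = 2 * \<alpha> + 1"
      by (simp_all add: t_def symb_coeff_0 algebra_simps)
    show ?thesis using square_pochhammer_shift_ge[of "\<alpha> + 1" s k] \<alpha> s unfolding t0(2) t0(1) by simp
  qed
  have tb: "0 \<le> t * ?b k" for k using t b[of k] by (intro mult_nonneg_nonneg) auto
  have "t\<^sup>2 * W = (\<Sum>i\<le>M. (t * ?b i) * (t * ?b (M - i)))"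
  proof -
    have "W = (\<Sum>i\<le>M. ?b i * ?b (M - i))"
      unfolding W_def pochhammer_div_fact_convolution by (simp add: algebra_simps)
    then show ?thesis by (simp only: power2_eq_square sum_distrib_left mult_ac)
  qed
  also have "\<dots> \<le> (\<Sum>i\<le>M. (v (i + s))\<^sup>2)"
  proof (rule sum_mono)
    fix i assume "i \<in> {..M}"
    then have "v (i + s) = ?a (i + s) * ?a (M - i + s)"
      by (simp add: v_def torsion_def N_def add.commute)
    moreover have "(t * ?b i) * (t * ?b (M - i)) \<le> (?a (i + s))\<^sup>2 * (?a (M - i + s))\<^sup>2"
      by (intro mult_mono sq tb zero_le_power2)
    ultimately show "(t * ?b i) * (t * ?b (M - i)) \<le> (v (i + s))\<^sup>2"
      by (simp only: power_mult_distrib)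
  qed
  also have "\<dots> = (\<Sum>k\<in>(\<lambda>i. i + s) ` {..M}. (v k)\<^sup>2)"
    by (subst sum.reindex) (auto simp: inj_on_def)
  also have "\<dots> \<le> (\<Sum>k\<le>N. (v k)\<^sup>2)"
    by (intro sum_mono2) (auto simp: N_def)
  finally have V: "t\<^sup>2 * W \<le> (\<Sum>k\<le>N. (v k)\<^sup>2)" .
  have tW: "t\<^sup>2 * W > 0" using t W by simp
  have "lambda_min (symbol_toeplitz \<alpha> N) * (\<Sum>k\<le>N. (v k)\<^sup>2) \<le> t * X"
    unfolding toeplitz_symbol[OF \<alpha>] Q[symmetric] lessThan_Suc_atMost[symmetric]
    by (rule lambda_min_le_rayleigh) (use symb_coeff_sym in auto)
  then have "lambda_min (symbol_toeplitz \<alpha> N) \<le> t * X / (\<Sum>k\<le>N. (v k)\<^sup>2)"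
    using V tW by (subst pos_le_divide_eq) auto
  also have "\<dots> \<le> t * X / (t\<^sup>2 * W)"
    using V tW t X by (intro divide_left_mono) (auto intro!: mult_pos_pos)
  also have "\<dots> = X / (t * W)" using t by (simp add: power2_eq_square)
  finally show ?thesis unfolding N_def X_def W_def t_def .
qed

text \<open>Both bounds for \<open>lambda_min\<close> are multiplied by N^(2\<alpha>), and each
  Pochhammer quotient is replaced by its power-law asymptotics.\<close>

lemma symbol_constant_bounds:
  fixes \<alpha> C :: real
  assumes \<alpha>: "\<alpha> > 1 / 2"
    and lim: "(\<lambda>N. real N powr (2 * \<alpha>) * lambda_min (symbol_toeplitz \<alpha> N)) \<longlonglongrightarrow> C"
  shows "2 * \<alpha> * (Gamma \<alpha>)\<^sup>2 * Gamma (4 * \<alpha>) / (Gamma (2 * \<alpha> - 1) * Gamma (2 * \<alpha> + 1)) \<le> C"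
    "C \<le> (Gamma (\<alpha> + 1))\<^sup>2 * Gamma (4 * \<alpha> + 2) / (Gamma (2 * \<alpha> + 1) * Gamma (2 * \<alpha> + 2))"
proof -
  define K where "K = 2 * \<alpha> * (Gamma \<alpha>)\<^sup>2 / Gamma (2 * \<alpha> - 1)"
  have G: "Gamma (4 * \<alpha>) \<noteq> 0" "Gamma (4 * \<alpha> + 2) \<noteq> 0"
    using \<alpha> by (intro less_imp_neq[THEN not_sym] Gamma_real_pos; simp)+
  \<comment> \<open>The factor N / (N + 1) is what remains after normalising: (N + 1)! exceeds N! by
    N + 1, and the powers of N leave one N.\<close>
  have "(\<lambda>N. K * ((pochhammer (2 * \<alpha> + 1) (N + 0) / fact (N + 0) / real N powr (2 * \<alpha> + 1 - 1)) /
       (pochhammer (4 * \<alpha>) (N + 1) / fact (N + 1) / real N powr (4 * \<alpha> - 1)) * (real N / (real N + 1))))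
     \<longlonglongrightarrow> K * ((1 / Gamma (2 * \<alpha> + 1)) / (1 / Gamma (4 * \<alpha>)) * 1)"
  proof (intro tendsto_mult tendsto_divide[OF pochhammer_over_fact_asymp pochhammer_over_fact_asymp] tendsto_const)
    show "(\<lambda>N. real N / (real N + 1)) \<longlonglongrightarrow> 1" by real_asymp
  qed (use G \<alpha> in auto)
  moreover have "\<forall>\<^sub>F N in sequentially. K * ((pochhammer (2 * \<alpha> + 1) (N + 0) / fact (N + 0) / real N powr (2 * \<alpha> + 1 - 1)) /
       (pochhammer (4 * \<alpha>) (N + 1) / fact (N + 1) / real N powr (4 * \<alpha> - 1)) * (real N / (real N + 1)))
     = real N powr (2 * \<alpha>) * (K * (pochhammer (2 * \<alpha> + 1) N / pochhammer (4 * \<alpha>) (Suc N)))"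
    using eventually_gt_at_top[of 0]
  proof eventually_elim
    case (elim N)
    have p: "real N powr (4 * \<alpha> - 1) = real N powr (2 * \<alpha>) * real N powr (2 * \<alpha>) / real N"
      using elim by (simp add: powr_diff powr_add[symmetric])
    have f: "fact (N + 1) = (real N + 1) * fact N" by simp
    show ?case unfolding p f using elim by (simp add: divide_simps del: fact_Suc)
  qed
  ultimately have "(\<lambda>N. real N powr (2 * \<alpha>) * (K * (pochhammer (2 * \<alpha> + 1) N / pochhammer (4 * \<alpha>) (Suc N))))
     \<longlonglongrightarrow> K * ((1 / Gamma (2 * \<alpha> + 1)) / (1 / Gamma (4 * \<alpha>)) * 1)"
    by (rule Lim_transform_eventually)
  then have "K * ((1 / Gamma (2 * \<alpha> + 1)) / (1 / Gamma (4 * \<alpha>)) * 1) \<le> C"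
    by (rule LIMSEQ_le[OF _ lim])
      (intro exI[of _ 0] allI impI mult_left_mono powr_ge_zero lambda_min_symbol_lower[OF \<alpha>, folded K_def])
  then show "2 * \<alpha> * (Gamma \<alpha>)\<^sup>2 * Gamma (4 * \<alpha>) / (Gamma (2 * \<alpha> - 1) * Gamma (2 * \<alpha> + 1)) \<le> C"
    by (simp add: K_def)
  \<comment> \<open>This shift stays fixed as M grows, so N = M + 2s merely skips an initial segment
    of the sequence.\<close>
  define s where "s = nat \<lceil>\<alpha> / 2\<rceil>"
  have s: "real s \<ge> \<alpha> / 2" unfolding s_def by linarith
  define t where "t = symb_coeff \<alpha> 0"
  have "(\<lambda>M. 1 / t * ((pochhammer (2 * \<alpha> + 2) (M + 2 * s) / fact (M + 2 * s) / real M powr (2 * \<alpha> + 2 - 1)) /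
       (pochhammer (4 * \<alpha> + 2) (M + 0) / fact (M + 0) / real M powr (4 * \<alpha> + 2 - 1)) *
       (real (M + 2 * s) powr (2 * \<alpha>) / real M powr (2 * \<alpha>))))
     \<longlonglongrightarrow> 1 / t * ((1 / Gamma (2 * \<alpha> + 2)) / (1 / Gamma (4 * \<alpha> + 2)) * 1)"
  proof (intro tendsto_mult tendsto_divide[OF pochhammer_over_fact_asymp pochhammer_over_fact_asymp] tendsto_const)
    show "(\<lambda>M. real (M + 2 * s) powr (2 * \<alpha>) / real M powr (2 * \<alpha>)) \<longlonglongrightarrow> 1" by real_asymp
  qed (use G \<alpha> in auto)
  moreover have "\<forall>\<^sub>F M in sequentially. 1 / t * ((pochhammer (2 * \<alpha> + 2) (M + 2 * s) / fact (M + 2 * s) / real M powr (2 * \<alpha> + 2 - 1)) /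
       (pochhammer (4 * \<alpha> + 2) (M + 0) / fact (M + 0) / real M powr (4 * \<alpha> + 2 - 1)) *
       (real (M + 2 * s) powr (2 * \<alpha>) / real M powr (2 * \<alpha>)))
     = real (M + 2 * s) powr (2 * \<alpha>) * ((pochhammer (2 * \<alpha> + 2) (M + 2 * s) / fact (M + 2 * s)) /
       (t * (pochhammer (4 * \<alpha> + 2) M / fact M)))"
    using eventually_gt_at_top[of 0]
  proof eventually_elim
    case (elim M)
    have p: "real M powr (4 * \<alpha> + 2 - 1) = real M powr (2 * \<alpha> + 2 - 1) * real M powr (2 * \<alpha>)"
      using elim by (simp add: powr_add[symmetric] algebra_simps)
    show ?case unfolding p using elim by simp (simp only: mult_ac)
  qed
  ultimately have up: "(\<lambda>M. real (M + 2 * s) powr (2 * \<alpha>) * ((pochhammer (2 * \<alpha> + 2) (M + 2 * s) / fact (M + 2 * s)) /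
       (t * (pochhammer (4 * \<alpha> + 2) M / fact M)))) \<longlonglongrightarrow> 1 / t * ((1 / Gamma (2 * \<alpha> + 2)) / (1 / Gamma (4 * \<alpha> + 2)) * 1)"
    by (rule Lim_transform_eventually)
  have "(\<lambda>M. real (M + 2 * s) powr (2 * \<alpha>) * lambda_min (symbol_toeplitz \<alpha> (M + 2 * s))) \<longlonglongrightarrow> C"
    using lim by (rule LIMSEQ_ignore_initial_segment)
  then have "C \<le> 1 / t * ((1 / Gamma (2 * \<alpha> + 2)) / (1 / Gamma (4 * \<alpha> + 2)) * 1)"
    by (rule LIMSEQ_le[OF _ up])
      (intro exI[of _ 0] allI impI mult_left_mono powr_ge_zero lambda_min_symbol_upper[OF \<alpha> s, folded t_def])
  then show "C \<le> (Gamma (\<alpha> + 1))\<^sup>2 * Gamma (4 * \<alpha> + 2) / (Gamma (2 * \<alpha> + 1) * Gamma (2 * \<alpha> + 2))"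
    by (simp add: t_def symb_coeff_0)
qed

section \<open>Stirling's formula with error bound\<close>

text \<open>The unnormalised Stirling remainder: the constant ln(2 pi)/2 is not subtracted, so that
  it can be found as the limit.\<close>

definition stirling_rest :: "real \<Rightarrow> real" where
  "stirling_rest x = ln (Gamma x) - (x - 1/2) * ln x + x"

text \<open>The midpoint and trapezoid estimates for the integral of 1/t over [x, x+1] give the two
  bounds. The upper one is written as a difference so that it telescopes.\<close>

lemma stirling_rest_step:
  assumes x: "x > 0"
  shows "0 \<le> stirling_rest x - stirling_rest (x + 1)"
    "stirling_rest x - stirling_rest (x + 1) \<le> 1 / (4 * x) - 1 / (4 * (x + 1))"
proof -
  have "x \<notin> \<int>\<^sub>\<le>\<^sub>0" using x by (auto elim!: nonpos_Ints_cases')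
  then have "ln (Gamma (x + 1)) = ln x + ln (Gamma x)"
    using x Gamma_real_pos[OF x] by (simp add: Gamma_plus1 ln_mult_pos)
  then have eq: "stirling_rest x - stirling_rest (x + 1) = (x + 1/2) * (ln (x + 1) - ln x) - 1"
    by (simp add: stirling_rest_def algebra_simps)
  have "2 / (2 * x + 1) \<le> ln (x + 1) - ln x"
    using ln_inverse_approx_ge[of x "x + 1"] x by (simp add: algebra_simps)
  then have "(x + 1/2) * (2 / (2 * x + 1)) \<le> (x + 1/2) * (ln (x + 1) - ln x)"
    using x by (intro mult_left_mono) auto
  moreover have "(x + 1/2) * (2 / (2 * x + 1)) = 1" using x by (simp add: field_simps)
  ultimately show "0 \<le> stirling_rest x - stirling_rest (x + 1)" unfolding eq by linarith
  have "ln (x + 1) - ln x \<le> (1 / x + 1 / (x + 1)) / 2"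
    using ln_inverse_approx_le[of x 1] x by (simp add: inverse_eq_divide)
  then have "(x + 1/2) * (ln (x + 1) - ln x) \<le> (x + 1/2) * ((1 / x + 1 / (x + 1)) / 2)"
    using x by (intro mult_left_mono) auto
  also have "\<dots> = 1 + (1 / (4 * x) - 1 / (4 * (x + 1)))"
    using x by (simp add: divide_simps) (simp add: algebra_simps)
  finally show "stirling_rest x - stirling_rest (x + 1) \<le> 1 / (4 * x) - 1 / (4 * (x + 1))"
    unfolding eq by simp
qed

lemma stirling_rest_steps:
  assumes x: "x > 0"
  shows "0 \<le> stirling_rest x - stirling_rest (x + real n)"
    "stirling_rest x - stirling_rest (x + real n) \<le> 1 / (4 * x) - 1 / (4 * (x + real n))"
proof (induction n)
  case (Suc n)
  have "x + real n > 0" using x by simp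
  note step = stirling_rest_step[OF this]
  have *: "x + real (Suc n) = x + real n + 1" by simp
  {
    case 1
    then show ?case unfolding * using step(1) Suc(1) by linarith
  next
    case 2
    then show ?case unfolding * using step(2) Suc(2) by linarith
  }
qed auto

text \<open>Euler's limit for Gamma(x) compares Gamma(x + n) with n^x Gamma(n), and the elementary
  terms cancel asymptotically. Hence the limit of the remainder is the same along every real
  shift.\<close>

lemma stirling_rest_shift_LIMSEQ:
  assumes x: "x > 0"
  shows "(\<lambda>n. stirling_rest (x + real n) - stirling_rest (real n)) \<longlonglongrightarrow> 0"
proof -
  have pos: "Gamma x > 0" using x by simp
  have nz: "x \<notin> \<int>\<^sub>\<le>\<^sub>0" using x by (auto elim!: nonpos_Ints_cases')
  have "(\<lambda>n. ln (Gamma x) - ln (Gamma_series' x n)) \<longlonglongrightarrow> ln (Gamma x) - ln (Gamma x)"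
    using pos by (intro tendsto_intros Gamma_series'_LIMSEQ) auto
  moreover have "(\<lambda>n. x * ln (real n) - (x + real n - 1/2) * ln (x + real n) + (real n - 1/2) * ln (real n) + x) \<longlonglongrightarrow> 0"
    by real_asymp
  ultimately have "(\<lambda>n. (ln (Gamma x) - ln (Gamma_series' x n)) +
     (x * ln (real n) - (x + real n - 1/2) * ln (x + real n) + (real n - 1/2) * ln (real n) + x)) \<longlonglongrightarrow> ln (Gamma x) - ln (Gamma x) + 0"
    by (rule tendsto_add)
  moreover have "\<forall>\<^sub>F n in sequentially. (ln (Gamma x) - ln (Gamma_series' x n)) +
     (x * ln (real n) - (x + real n - 1/2) * ln (x + real n) + (real n - 1/2) * ln (real n) + x)
     = stirling_rest (x + real n) - stirling_rest (real n)"
    using eventually_gt_at_top[of 0]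
  proof eventually_elim
    case (elim n)
    have G: "Gamma (real n) > 0" "Gamma (x + real n) > 0" using elim x by auto
    have "pochhammer x n = Gamma (x + real n) / Gamma x" using nz by (rule pochhammer_Gamma)
    moreover have "fact (n - 1) = Gamma (real n)"
      using elim Gamma_fact[of "n - 1", where 'a = real] by (simp add: of_nat_diff)
    ultimately have "Gamma_series' x n = Gamma (real n) * exp (x * ln (real n)) * Gamma x / Gamma (x + real n)"
      by (simp add: Gamma_series'_def)
    then have "ln (Gamma_series' x n) = ln (Gamma (real n)) + x * ln (real n) + ln (Gamma x) - ln (Gamma (x + real n))"
      using G pos by (simp add: ln_div ln_mult)
    then show ?case by (simp add: stirling_rest_def algebra_simps)
  qed
  ultimately show ?thesis using Lim_transform_eventually by fastforce
qed

text \<open>A limit L exists by monotonicity and boundedness. The duplication formula relates the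
  remainders at n, n + 1/2 and 2n, all tending to L, and so determines L + L - L.\<close>

lemma stirling_rest_of_nat_LIMSEQ: "(\<lambda>n. stirling_rest (real n)) \<longlonglongrightarrow> ln (2 * pi) / 2"
proof -
  let ?r = stirling_rest
  have "decseq (\<lambda>n. ?r (1 + real n))"
  proof (rule decseq_SucI)
    fix n show "?r (1 + real (Suc n)) \<le> ?r (1 + real n)"
      using stirling_rest_step(1)[of "1 + real n"] by (simp add: add_ac)
  qed
  moreover have "?r 1 - 1 / 4 \<le> ?r (1 + real n)" for n
  proof -
    have "1 / (4 * (1 + real n)) \<ge> 0" by simp
    then show ?thesis using stirling_rest_steps(2)[of 1 n] by linarith
  qed
  ultimately obtain L where "(\<lambda>n. ?r (1 + real n)) \<longlonglongrightarrow> L"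
    by (metis decseq_convergent)
  then have "(\<lambda>n. ?r (real (Suc n))) \<longlonglongrightarrow> L" by (simp add: add.commute)
  then have L: "(\<lambda>n. ?r (real n)) \<longlonglongrightarrow> L" by (rule LIMSEQ_imp_Suc)
  have "(\<lambda>n. ?r (1/2 + real n) - ?r (real n) + ?r (real n)) \<longlonglongrightarrow> 0 + L"
    by (intro tendsto_add stirling_rest_shift_LIMSEQ L) simp
  then have L2: "(\<lambda>n. ?r (real n + 1/2)) \<longlonglongrightarrow> L" by (simp add: add.commute)
  have L3: "(\<lambda>n. ?r (real (2 * n))) \<longlonglongrightarrow> L"
    using LIMSEQ_subseq_LIMSEQ[OF L, of "\<lambda>n. 2 * n"] by (simp add: o_def strict_mono_def)
  have "(\<lambda>n. ?r (real n) + ?r (real n + 1/2) - ?r (real (2 * n))) \<longlonglongrightarrow> L + L - L"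
    by (intro tendsto_intros L L2 L3)
  note lim1 = this
  have lim2: "(\<lambda>n. ln pi / 2 + ((1 - 2 * real n) * ln 2 - (real n - 1/2) * ln (real n) - real n * ln (real n + 1/2)
      + (2 * real n - 1/2) * ln (2 * real n) + 1/2)) \<longlonglongrightarrow> ln pi / 2 + ln 2 / 2"
    by (intro tendsto_add tendsto_const) real_asymp
  have eq: "\<forall>\<^sub>F n in sequentially. ln pi / 2 + ((1 - 2 * real n) * ln 2 - (real n - 1/2) * ln (real n) - real n * ln (real n + 1/2)
      + (2 * real n - 1/2) * ln (2 * real n) + 1/2) = ?r (real n) + ?r (real n + 1/2) - ?r (real (2 * n))"
    using eventually_gt_at_top[of 0]
  proof eventually_elim
    case (elim n)
    have G: "Gamma (real n) > 0" "Gamma (real n + 1/2) > 0" "Gamma (2 * real n) > 0" using elim by auto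
    have "ln (Gamma (real n) * Gamma (real n + 1/2)) = ln (2 powr (1 - 2 * real n) * sqrt pi * Gamma (2 * real n))"
      using elim by (subst Gamma_legendre_duplication_real) auto
    then have "ln (Gamma (real n)) + ln (Gamma (real n + 1/2)) = (1 - 2 * real n) * ln 2 + ln pi / 2 + ln (Gamma (2 * real n))"
      using G by (simp add: ln_mult ln_sqrt ln_powr)
    then show ?case by (simp add: stirling_rest_def algebra_simps)
  qed
  have "L + L - L = ln pi / 2 + ln 2 / 2"
    by (rule LIMSEQ_unique[OF lim1 Lim_transform_eventually[OF lim2 eq]])
  then have "L = ln (2 * pi) / 2" by (simp add: ln_mult field_simps)
  then show ?thesis using L by (simp only:)
qed

lemma stirling_rest_bounds:
  assumes x: "x > 0"
  shows "ln (2 * pi) / 2 \<le> stirling_rest x" "stirling_rest x \<le> ln (2 * pi) / 2 + 1 / (4 * x)"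
proof -
  have "(\<lambda>n. stirling_rest (x + real n) - stirling_rest (real n) + stirling_rest (real n)) \<longlonglongrightarrow> 0 + ln (2 * pi) / 2"
    by (intro tendsto_add stirling_rest_shift_LIMSEQ stirling_rest_of_nat_LIMSEQ x)
  then have lim: "(\<lambda>n. stirling_rest (x + real n)) \<longlonglongrightarrow> ln (2 * pi) / 2" by simp
  show "ln (2 * pi) / 2 \<le> stirling_rest x"
    by (rule LIMSEQ_le_const2[OF lim]) (use stirling_rest_steps(1)[OF x] in force)
  have "stirling_rest x - 1 / (4 * x) \<le> stirling_rest (x + real n)" for n
  proof -
    have "1 / (4 * (x + real n)) \<ge> 0" using x by simp
    then show ?thesis using stirling_rest_steps(2)[OF x, of n] by linarith
  qed
  then have "stirling_rest x - 1 / (4 * x) \<le> ln (2 * pi) / 2"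
    by (intro LIMSEQ_le_const[OF lim]) blast
  then show "stirling_rest x \<le> ln (2 * pi) / 2 + 1 / (4 * x)" by simp
qed

lemma Gamma_eq_exp_stirling_rest:
  assumes "x > 0"
  shows "Gamma x = exp ((x - 1/2) * ln x - x + stirling_rest x)"
  using assms by (simp add: stirling_rest_def)

section \<open>Asymptotics of the constant\<close>

lemma fourier_coeff_one:
  assumes "n \<noteq> 0"
  shows "fourier_coeff (\<lambda>z. 1) n = 0"
proof -
  let ?g = "\<lambda>\<theta>. cis (- of_int n * \<theta>)" and ?n = "complex_of_int n"
  define F where "F = (\<lambda>\<theta>. \<i> / ?n * exp (of_real \<theta> * (- \<i> * ?n)))"
  have "(F has_vector_derivative ?g \<theta>) (at \<theta> within {-pi..pi})" for \<theta>
  proof -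
    have "((\<lambda>z. \<i> / ?n * exp (z * (- \<i> * ?n))) has_field_derivative exp (of_real \<theta> * (- \<i> * ?n))) (at (of_real \<theta>))"
      using assms by (auto intro!: derivative_eq_intros)
    then have "(F has_vector_derivative exp (of_real \<theta> * (- \<i> * ?n))) (at \<theta> within {-pi..pi})"
      unfolding F_def by (rule has_vector_derivative_real_field)
    then show ?thesis by (simp add: cis_conv_exp mult_ac)
  qed
  then have "(?g has_integral (F pi - F (- pi))) {-pi..pi}"
    by (intro fundamental_theorem_of_calculus) auto
  moreover have "F pi = F (- pi)"
  proof -
    have "exp (of_real pi * (- \<i> * ?n)) = exp (of_real (- pi) * (- \<i> * ?n))"
      unfolding exp_eq by (intro exI[of _ "- n"]) (simp add: algebra_simps)
    then show ?thesis by (simp only: F_def)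
  qed
  ultimately have "(?g has_integral 0) {-pi..pi}" by simp
  then have "integral {-pi..pi} ?g = 0" by (simp add: integral_unique)
  moreover have "set_integrable lborel {-pi..pi} ?g"
    by (intro borel_integrable_atLeastAtMost' continuous_intros)
  ultimately show ?thesis
    by (simp add: fourier_coeff_def set_borel_integral_eq_integral(2))
qed

text \<open>Every weighted coefficient vanishes: for n = 0 the weight is 0, because
  \<open>0 powr \<nu> = 0\<close>.\<close>

lemma one_in_A_torus: "(\<lambda>z. 1) \<in> A_torus \<nu>"
proof -
  have "(\<lambda>n::int. \<bar>real_of_int n\<bar> powr \<nu> * cmod (fourier_coeff (\<lambda>z. 1) n)) = (\<lambda>n. 0)"
  proof
    show "\<bar>real_of_int n\<bar> powr \<nu> * cmod (fourier_coeff (\<lambda>z. 1) n) = 0" for n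
      by (cases "n = 0") (simp_all add: fourier_coeff_one)
  qed
  then have "(\<lambda>n::int. \<bar>real_of_int n\<bar> powr \<nu> * cmod (fourier_coeff (\<lambda>z. 1) n)) summable_on UNIV"
    by (simp only: summable_on_0)
  moreover have "set_integrable lborel {-pi..pi} (\<lambda>\<theta>. (cmod 1)\<^sup>2 :: real)"
    by (intro borel_integrable_atLeastAtMost' continuous_intros)
  moreover have "set_borel_measurable lborel {-pi..pi} (\<lambda>\<theta>. 1 :: complex)"
    by (simp add: set_borel_measurable_def)
  ultimately show ?thesis by (simp add: A_torus_def L2_torus_def)
qed

section \<open>Comparison of the bounds with the main term\<close>

definition main_term :: "real \<Rightarrow> real" where
  "main_term \<alpha> = sqrt (8 * pi * \<alpha>) * (4 * \<alpha> / exp 1) powr (2 * \<alpha>)"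

lemma main_term_pos: "\<alpha> > 0 \<Longrightarrow> main_term \<alpha> > 0"
  by (simp add: main_term_def)

lemma Gamma_quotient_main_term:
  assumes \<alpha>: "\<alpha> > 0"
  obtains r where "\<bar>r\<bar> \<le> 1 / \<alpha>"
    "2 * \<alpha> * (Gamma (4 * \<alpha>) * (Gamma \<alpha>)\<^sup>2 / (Gamma (2 * \<alpha>))\<^sup>2) = main_term \<alpha> * exp r"
proof
  \<comment> \<open>The limits of the remainders add up to 1 + 2 - 2 = 1 copy of ln(2 pi)/2. This
    copy belongs to the main term and is subtracted, which leaves an error of order
    1/\<alpha>.\<close>
  define r where "r = stirling_rest (4 * \<alpha>) + 2 * stirling_rest \<alpha> - 2 * stirling_rest (2 * \<alpha>) - ln (2 * pi) / 2"
  show "\<bar>r\<bar> \<le> 1 / \<alpha>"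
  proof -
    have "1 / (4 * (4 * \<alpha>)) = 1 / 16 * (1 / \<alpha>)" "1 / (4 * \<alpha>) = 1 / 4 * (1 / \<alpha>)" "1 / (4 * (2 * \<alpha>)) = 1 / 8 * (1 / \<alpha>)"
      by simp_all
    moreover have "1 / \<alpha> > 0" using \<alpha> by simp
    ultimately show ?thesis
      using stirling_rest_bounds[of "4 * \<alpha>"] stirling_rest_bounds[of \<alpha>] stirling_rest_bounds[of "2 * \<alpha>"] \<alpha>
      unfolding r_def by linarith
  qed
  have l: "ln (2 * \<alpha>) = ln 2 + ln \<alpha>" "ln (4 * \<alpha>) = 2 * ln 2 + ln \<alpha>"
    using \<alpha> ln_realpow[of 2 2] by (simp_all add: ln_mult)
  have l8: "ln (8 * pi * \<alpha>) = 2 * ln 2 + ln (2 * pi) + ln \<alpha>"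
  proof -
    have "8 * pi * \<alpha> = 2 ^ 2 * (2 * pi) * \<alpha>" by simp
    then show ?thesis using \<alpha> by (simp only: ln_mult ln_realpow) (simp add: ln_mult ln_realpow)
  qed
  have "main_term \<alpha> = exp (ln (8 * pi * \<alpha>) / 2) * exp (2 * \<alpha> * (ln (4 * \<alpha>) - 1))"
  proof -
    have "sqrt (8 * pi * \<alpha>) = exp (ln (8 * pi * \<alpha>) / 2)"
      using \<alpha> by (simp add: ln_sqrt[symmetric])
    moreover have "(4 * \<alpha> / exp 1) powr (2 * \<alpha>) = exp (2 * \<alpha> * (ln (4 * \<alpha>) - 1))"
      using \<alpha> by (simp add: powr_def ln_div)
    ultimately show ?thesis by (simp add: main_term_def)
  qed
  then have "main_term \<alpha> * exp r = exp (ln (8 * pi * \<alpha>) / 2 + 2 * \<alpha> * (ln (4 * \<alpha>) - 1) + r)"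
    by (simp add: exp_add)
  also have "\<dots> = exp (ln (2 * \<alpha>) + ((4 * \<alpha> - 1/2) * ln (4 * \<alpha>) - 4 * \<alpha> + stirling_rest (4 * \<alpha>))
      + 2 * ((\<alpha> - 1/2) * ln \<alpha> - \<alpha> + stirling_rest \<alpha>)
      - 2 * ((2 * \<alpha> - 1/2) * ln (2 * \<alpha>) - 2 * \<alpha> + stirling_rest (2 * \<alpha>)))"
    unfolding r_def l8 l by (rule arg_cong[of _ _ exp]) (simp add: algebra_simps)
  also have "\<dots> = 2 * \<alpha> * (Gamma (4 * \<alpha>) * (Gamma \<alpha>)\<^sup>2 / (Gamma (2 * \<alpha>))\<^sup>2)"
  proof -
    have "exp (ln (2 * \<alpha>) + a + 2 * b - 2 * d) = 2 * \<alpha> * (exp a * (exp b)\<^sup>2 / (exp d)\<^sup>2)" for a b d :: real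
      using \<alpha> by (simp add: exp_add exp_diff exp_double)
    then show ?thesis using \<alpha> by (simp only: Gamma_eq_exp_stirling_rest mult_pos_pos zero_less_numeral)
  qed
  finally show "2 * \<alpha> * (Gamma (4 * \<alpha>) * (Gamma \<alpha>)\<^sup>2 / (Gamma (2 * \<alpha>))\<^sup>2) = main_term \<alpha> * exp r" ..
qed

text \<open>By the functional equation both bounds are multiples of one Gamma quotient
  \<open>R\<close>, with factors 1 - 1/(2\<alpha>) and (4\<alpha> + 1)/(4\<alpha> + 2) < 1;
  Stirling's formula compares \<open>R\<close> with the main term.\<close>

lemma symbol_constant_asymp:
  fixes \<alpha> C :: real
  assumes \<alpha>: "\<alpha> \<ge> 1"
    and lim: "(\<lambda>N. real N powr (2 * \<alpha>) * lambda_min (symbol_toeplitz \<alpha> N)) \<longlonglongrightarrow> C"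
  shows "\<bar>C / main_term \<alpha> - 1\<bar> \<le> 2 / \<alpha>"
proof -
  define R where "R = 2 * \<alpha> * (Gamma (4 * \<alpha>) * (Gamma \<alpha>)\<^sup>2 / (Gamma (2 * \<alpha>))\<^sup>2)"
  obtain r where r: "\<bar>r\<bar> \<le> 1 / \<alpha>" and R: "R = main_term \<alpha> * exp r"
    using Gamma_quotient_main_term[of \<alpha>] \<alpha> unfolding R_def by auto
  have m: "main_term \<alpha> > 0" using \<alpha> by (intro main_term_pos) simp
  have step: "Gamma (x + 1) = x * Gamma x" if "x > 0" for x :: real
    using that by (intro Gamma_plus1) (auto elim!: nonpos_Ints_cases')
  have G: "Gamma (2 * \<alpha> + 1) = 2 * \<alpha> * Gamma (2 * \<alpha>)" "Gamma (2 * \<alpha> + 2) = (2 * \<alpha> + 1) * (2 * \<alpha> * Gamma (2 * \<alpha>))"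
    "Gamma (4 * \<alpha> + 2) = (4 * \<alpha> + 1) * (4 * \<alpha> * Gamma (4 * \<alpha>))" "Gamma (\<alpha> + 1) = \<alpha> * Gamma \<alpha>"
    "Gamma (2 * \<alpha>) = (2 * \<alpha> - 1) * Gamma (2 * \<alpha> - 1)"
    using step[of "2 * \<alpha>"] step[of "2 * \<alpha> + 1"] step[of "4 * \<alpha>"] step[of "4 * \<alpha> + 1"] step[of \<alpha>] step[of "2 * \<alpha> - 1"] \<alpha>
    by (simp_all add: add.assoc)
  have nz: "Gamma (2 * \<alpha>) \<noteq> 0" "Gamma (2 * \<alpha> - 1) \<noteq> 0"
    using \<alpha> by (intro less_imp_neq[THEN not_sym] Gamma_real_pos; simp)+
  have "2 * \<alpha> * (Gamma \<alpha>)\<^sup>2 * Gamma (4 * \<alpha>) / (Gamma (2 * \<alpha> - 1) * Gamma (2 * \<alpha> + 1)) = (1 - 1 / (2 * \<alpha>)) * R"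
  proof -
    define A where "A = Gamma (2 * \<alpha> - 1)"
    have "A \<noteq> 0" "2 * \<alpha> - 1 \<noteq> 0" "\<alpha> \<noteq> 0" using nz \<alpha> by (auto simp: A_def)
    then show ?thesis
      unfolding R_def G(1) G(5) A_def[symmetric] by (simp add: divide_simps) (simp add: power2_eq_square algebra_simps)
  qed
  then have lower: "(1 - 1 / (2 * \<alpha>)) * R \<le> C"
    using symbol_constant_bounds(1)[OF _ lim] \<alpha> by simp
  have "(Gamma (\<alpha> + 1))\<^sup>2 * Gamma (4 * \<alpha> + 2) / (Gamma (2 * \<alpha> + 1) * Gamma (2 * \<alpha> + 2)) = (4 * \<alpha> + 1) / (4 * \<alpha> + 2) * R"
  proof -
    define A where "A = Gamma (2 * \<alpha>)"
    have "A \<noteq> 0" "\<alpha> \<noteq> 0" "2 * \<alpha> + 1 \<noteq> 0" "4 * \<alpha> + 2 \<noteq> 0" using nz \<alpha> by (auto simp: A_def)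
    then show ?thesis
      unfolding R_def G(1-4) A_def[symmetric] by (simp add: divide_simps) (simp add: power2_eq_square algebra_simps)
  qed
  then have "C \<le> (4 * \<alpha> + 1) / (4 * \<alpha> + 2) * R"
    using symbol_constant_bounds(2)[OF _ lim] \<alpha> by simp
  also have "\<dots> \<le> 1 * R"
    using \<alpha> m by (intro mult_right_mono) (auto simp: R)
  finally have upper: "C \<le> R" by simp
  have inv: "0 < 1 / \<alpha>" "1 / \<alpha> \<le> 1" using \<alpha> by auto
  have "exp r \<le> exp (1 / \<alpha>)" using r by simp
  also have "\<dots> \<le> 1 + 1 / \<alpha> + (1 / \<alpha>)\<^sup>2" using inv by (intro exp_bound) auto
  also have "(1 / \<alpha>)\<^sup>2 \<le> 1 / \<alpha>" using inv power_decreasing[of 1 2 "1 / \<alpha>"] by simp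
  finally have e1: "exp r \<le> 1 + 2 / \<alpha>" by simp
  have e2: "exp r \<ge> 1 - 1 / \<alpha>"
    using exp_ge_add_one_self[of r] r by linarith
  have "C / main_term \<alpha> \<le> exp r"
    using upper m by (simp add: R divide_le_eq mult.commute)
  then have "C / main_term \<alpha> - 1 \<le> 2 / \<alpha>" using e1 by simp
  moreover have "1 - 2 / \<alpha> \<le> C / main_term \<alpha>"
  proof -
    have "1 - 2 / \<alpha> \<le> (1 - 1 / (2 * \<alpha>)) * (1 - 1 / \<alpha>)"
    proof -
      have "1 / (2 * \<alpha>) = 1 / \<alpha> / 2" by simp
      moreover have "1 - 2 * x \<le> (1 - x / 2) * (1 - x)" if "0 < x" for x :: real
        using that zero_le_power2[of x] by (simp add: power2_eq_square algebra_simps)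
      from this[OF inv(1)] have "1 - 2 * (1 / \<alpha>) \<le> (1 - 1 / \<alpha> / 2) * (1 - 1 / \<alpha>)" .
      ultimately show ?thesis by (simp add: mult.commute)
    qed
    also have "\<dots> \<le> (1 - 1 / (2 * \<alpha>)) * exp r"
      using e2 \<alpha> by (intro mult_left_mono) auto
    also have "\<dots> \<le> C / main_term \<alpha>"
      using lower m by (simp add: R pos_le_divide_eq mult_ac)
    finally show ?thesis .
  qed
  ultimately show ?thesis by (simp add: abs_le_iff)
qed

theorem mainTheorem5:
  fixes c :: "real \<Rightarrow> real"
  assumes c_def: "\<And>(\<alpha>::real) (f\<^sub>1::complex \<Rightarrow> real).
      \<lbrakk> \<alpha> > 0; \<alpha> \<noteq> 1/2;
        (\<lambda>z. complex_of_real (f\<^sub>1 z)) \<in> A_torus (3/2);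
        continuous_on (sphere 0 1) f\<^sub>1;
        \<forall>z\<in>sphere 0 1. f\<^sub>1 z > 0 \<rbrakk> \<Longrightarrow>
      (\<lambda>N. lambda_min (toeplitz N (\<lambda>z. complex_of_real (cmod (1 - z) powr (2 * \<alpha>) * f\<^sub>1 z))))
        \<sim>[sequentially] (\<lambda>N. c \<alpha> / real N powr (2 * \<alpha>) * f\<^sub>1 1)"
  shows "\<exists>\<epsilon>::real \<Rightarrow> real. \<epsilon> \<in> O[at_top](\<lambda>\<alpha>. 1 / sqrt \<alpha>) \<and>
      (\<forall>\<^sub>F \<alpha> in at_top.
         c \<alpha> = sqrt (8 * pi * \<alpha>) * (4 * \<alpha> / exp 1) powr (2 * \<alpha>) * (1 + \<epsilon> \<alpha>))"
proof (intro exI[of _ "\<lambda>\<alpha>. c \<alpha> / main_term \<alpha> - 1"] conjI)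
  \<comment> \<open>The witness is the relative error itself, so the asserted equation only needs a
    nonzero main term, and the content lies in this estimate, obtained from the choice f_1 =
    1.\<close>
  have bound: "\<bar>c \<alpha> / main_term \<alpha> - 1\<bar> \<le> 2 / \<alpha>" if \<alpha>: "\<alpha> \<ge> 1" for \<alpha>
  proof (rule symbol_constant_asymp[OF \<alpha>])
    have "(\<lambda>N. lambda_min (symbol_toeplitz \<alpha> N)) \<sim>[sequentially] (\<lambda>N. c \<alpha> / real N powr (2 * \<alpha>))"
      using c_def[of \<alpha> "\<lambda>_. 1"] \<alpha> one_in_A_torus[of "3/2"] by simp
    then have "(\<lambda>N. real N powr (2 * \<alpha>) * lambda_min (symbol_toeplitz \<alpha> N))
        \<sim>[sequentially] (\<lambda>N. real N powr (2 * \<alpha>) * (c \<alpha> / real N powr (2 * \<alpha>)))"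
      by (intro asymp_equiv_intros)
    moreover have "(\<lambda>N. real N powr (2 * \<alpha>) * (c \<alpha> / real N powr (2 * \<alpha>))) \<longlonglongrightarrow> c \<alpha>"
    proof (rule tendsto_eventually)
      show "\<forall>\<^sub>F N in sequentially. real N powr (2 * \<alpha>) * (c \<alpha> / real N powr (2 * \<alpha>)) = c \<alpha>"
        using eventually_gt_at_top[of 0] by eventually_elim auto
    qed
    ultimately show "(\<lambda>N. real N powr (2 * \<alpha>) * lambda_min (symbol_toeplitz \<alpha> N)) \<longlonglongrightarrow> c \<alpha>"
      using tendsto_asymp_equiv_cong by blast
  qed
  show "(\<lambda>\<alpha>. c \<alpha> / main_term \<alpha> - 1) \<in> O[at_top](\<lambda>\<alpha>. 1 / sqrt \<alpha>)"
  proof (rule bigoI)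
    show "\<forall>\<^sub>F \<alpha> in at_top. norm (c \<alpha> / main_term \<alpha> - 1) \<le> 2 * norm (1 / sqrt \<alpha>)"
      using eventually_ge_at_top[of 1]
    proof eventually_elim
      case (elim \<alpha>)
      have "sqrt \<alpha> \<le> \<alpha>" using elim by (intro real_le_lsqrt) (auto simp: power2_eq_square)
      then have "2 / \<alpha> \<le> 2 / sqrt \<alpha>" using elim by (intro divide_left_mono) auto
      then show ?case using bound[OF elim] elim by simp
    qed
  qed
  show "\<forall>\<^sub>F \<alpha> in at_top.
      c \<alpha> = sqrt (8 * pi * \<alpha>) * (4 * \<alpha> / exp 1) powr (2 * \<alpha>) * (1 + (c \<alpha> / main_term \<alpha> - 1))"
    using eventually_gt_at_top[of 0]
  proof eventually_elim
    case (elim \<alpha>)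
    then show ?case using main_term_pos[of \<alpha>] unfolding main_term_def[symmetric] by simp
  qed
qed

end
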